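(* Let $f\in H_1(\mathbb T^\infty)$ and $k>0$. Then for almost all $z\in\mathbb T^\infty$ $$\lim_{x\to\infty}\sum_{\log(\mathfrak p^\alpha)<x}\widehat f(\alpha)\Big(1-\frac{\log(\mathfrak p^\alpha)}{x}\Big)^kz^\alpha=f(z).$$
   Context: $\mathbb T^\infty=\prod_{n=1}^\infty\mathbb T$ is the countably infinite-dimensional torus with its normalized Haar measure. Its characters are the monomials $z^\alpha=\prod_k z_k^{\alpha_k}$, where $\alpha=(\alpha_k)$ is a finite (i.e. finitely supported) sequence of integers, and $\widehat f(\alpha)=\int_{\mathbb T^\infty}f(z)\overline{z^\alpha}\,dz$. $H_1(\mathbb T^\infty)$ is the space of all $f\in L_1(\mathbb T^\infty)$ with $\widehat f(\alpha)=0$ whenever $\alpha_k<0$ for some $k$. $\mathfrak p=(p_k)$ is the sequence of prime numbers in increasing order and $\mathfrak p^\alpha=\prod_kp_k^{\alpha_k}$. The sum runs over all finitely supported sequences $\alpha$ of non-negative integers with $\log(\mathfrak p^\alpha)<x$ (a finite set). *)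

theory Defs
  imports "HOL-Probability.Probability" "HOL-Library.Poly_Mapping"
    "HOL-Computational_Algebra.Primes"
begin

text \<open>Normalized arc length on the unit circle; the Haar measure of the infinite torus is the
  countable power of this measure (cf. \<open>torus_translation\<close> below).\<close>

definition circle :: "complex measure" where
  "circle = distr (uniform_measure lborel {0..1::real}) (restrict_space borel (sphere 0 1))
     (\<lambda>t. cis (2 * pi * t))"

definition torus :: "(nat \<Rightarrow> complex) measure" where
  "torus = PiM UNIV (\<lambda>_. circle)"

definition character :: "(nat \<Rightarrow>\<^sub>0 int) \<Rightarrow> (nat \<Rightarrow> complex) \<Rightarrow> complex" where
  "character \<alpha> z = (\<Prod>j\<in>Poly_Mapping.keys \<alpha>. z j powi Poly_Mapping.lookup \<alpha> j)"

definition fourier_coeff :: "((nat \<Rightarrow> complex) \<Rightarrow> complex) \<Rightarrow> (nat \<Rightarrow>\<^sub>0 int) \<Rightarrow> complex" where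
  "fourier_coeff f \<alpha> = (LINT z|torus. f z * cnj (character \<alpha> z))"

text \<open>Elements of the Hardy space are represented by functions rather than by equivalence classes
  modulo null sets.\<close>

definition H1 :: "((nat \<Rightarrow> complex) \<Rightarrow> complex) set" where
  "H1 = {f. integrable torus f \<and> (\<forall>\<alpha>. (\<exists>j. Poly_Mapping.lookup \<alpha> j < 0) \<longrightarrow> fourier_coeff f \<alpha> = 0)}"

definition nth_prime :: "nat \<Rightarrow> nat" where
  "nth_prime = enumerate {p. prime p}"

definition prime_monomial :: "(nat \<Rightarrow>\<^sub>0 int) \<Rightarrow> real" where
  "prime_monomial \<alpha> = (\<Prod>j\<in>Poly_Mapping.keys \<alpha>. real (nth_prime j) powi Poly_Mapping.lookup \<alpha> j)"

definition multiindices_below :: "real \<Rightarrow> (nat \<Rightarrow>\<^sub>0 int) set" where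
  "multiindices_below x = {\<alpha>. (\<forall>j. 0 \<le> Poly_Mapping.lookup \<alpha> j) \<and> ln (prime_monomial \<alpha>) < x}"

lemma nth_prime: "prime (nth_prime j)"
  unfolding nth_prime_def using enumerate_in_set[OF primes_infinite] by blast

lemma nth_prime_gt: "j < nth_prime j"
proof (induction j)
  case 0 then show ?case using nth_prime[of 0] prime_gt_0_nat by blast
next
  case (Suc j)
  have "nth_prime j < nth_prime (Suc j)"
    unfolding nth_prime_def by (rule enumerate_step[OF primes_infinite])
  with Suc show ?case by simp
qed

lemma nth_prime_ge_2: "2 \<le> nth_prime j"
  using nth_prime prime_ge_2_nat by blast

lemma powi_le_prime_monomial:
  assumes "\<And>j. 0 \<le> Poly_Mapping.lookup \<alpha> j"
  shows "1 \<le> prime_monomial \<alpha>" "real (nth_prime j) powi Poly_Mapping.lookup \<alpha> j \<le> prime_monomial \<alpha>"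
proof -
  have ge: "1 \<le> real (nth_prime i) powi Poly_Mapping.lookup \<alpha> i" for i
    using assms[of i] nth_prime_ge_2[of i] by (simp add: power_int_def)
  show 1: "1 \<le> prime_monomial \<alpha>"
    unfolding prime_monomial_def using ge by (intro prod_ge_1) auto
  show "real (nth_prime j) powi Poly_Mapping.lookup \<alpha> j \<le> prime_monomial \<alpha>"
  proof (cases "j \<in> Poly_Mapping.keys \<alpha>")
    case True
    have "real (nth_prime j) powi Poly_Mapping.lookup \<alpha> j * 1 \<le> real (nth_prime j) powi Poly_Mapping.lookup \<alpha> j *
        (\<Prod>i\<in>Poly_Mapping.keys \<alpha> - {j}. real (nth_prime i) powi Poly_Mapping.lookup \<alpha> i)"
      using ge by (intro mult_left_mono prod_ge_1) (auto intro: order_trans[of 0 1])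
    also have "\<dots> = prime_monomial \<alpha>"
      unfolding prime_monomial_def using True by (subst (2) prod.remove[of _ j]) auto
    finally show ?thesis by simp
  next
    case False
    then show ?thesis using 1 by (simp add: in_keys_iff)
  qed
qed

text \<open>The sum over this index set is therefore an honest finite sum.\<close>

lemma finite_multiindices_below: "finite (multiindices_below x)"
proof -
  define N where "N = nat \<lceil>exp x\<rceil>"
  have N: "exp x \<le> real N" unfolding N_def by linarith
  have small: "real (nth_prime j) powi Poly_Mapping.lookup \<alpha> j < real N"
    if "\<alpha> \<in> multiindices_below x" for \<alpha> j
  proof -
    have nn: "\<And>j. 0 \<le> Poly_Mapping.lookup \<alpha> j" and l: "ln (prime_monomial \<alpha>) < x"
      using that by (auto simp: multiindices_below_def)
    have "prime_monomial \<alpha> = exp (ln (prime_monomial \<alpha>))"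
      using powi_le_prime_monomial(1)[OF nn] by simp
    also have "\<dots> < exp x" using l by simp
    finally show ?thesis
      using powi_le_prime_monomial(2)[OF nn, of j] N by linarith
  qed
  have val: "Poly_Mapping.lookup \<alpha> j \<in> {0..int N}" if "\<alpha> \<in> multiindices_below x" for \<alpha> j
  proof -
    have nn: "0 \<le> Poly_Mapping.lookup \<alpha> j" using that by (auto simp: multiindices_below_def)
    have "real (nat (Poly_Mapping.lookup \<alpha> j)) < 2 ^ nat (Poly_Mapping.lookup \<alpha> j)"
      by (rule of_nat_less_two_power)
    also have "\<dots> \<le> real (nth_prime j) ^ nat (Poly_Mapping.lookup \<alpha> j)"
      using nth_prime_ge_2[of j] by (intro power_mono) auto
    also have "\<dots> < real N" using small[OF that, of j] nn by (simp add: power_int_def)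
    finally show ?thesis using nn by auto
  qed
  have zero: "Poly_Mapping.lookup \<alpha> j = 0" if "\<alpha> \<in> multiindices_below x" "j \<ge> N" for \<alpha> j
  proof (rule ccontr)
    assume "Poly_Mapping.lookup \<alpha> j \<noteq> 0"
    with that(1) have pos: "0 < Poly_Mapping.lookup \<alpha> j"
      by (auto simp: multiindices_below_def order_less_le)
    have "real (nth_prime j) ^ 1 \<le> real (nth_prime j) ^ nat (Poly_Mapping.lookup \<alpha> j)"
      using pos nth_prime_ge_2[of j] by (intro power_increasing) auto
    also have "\<dots> < real N" using small[OF that(1), of j] pos by (simp add: power_int_def)
    finally show False using nth_prime_gt[of j] that(2) by simp
  qed
  have "inj_on (\<lambda>\<alpha>. restrict (Poly_Mapping.lookup \<alpha>) {..<N}) (multiindices_below x)"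
  proof (rule inj_onI)
    fix \<alpha> \<beta> assume A: "\<alpha> \<in> multiindices_below x" "\<beta> \<in> multiindices_below x"
      and E: "restrict (Poly_Mapping.lookup \<alpha>) {..<N} = restrict (Poly_Mapping.lookup \<beta>) {..<N}"
    have "Poly_Mapping.lookup \<alpha> j = Poly_Mapping.lookup \<beta> j" for j
      using zero[OF A(1), of j] zero[OF A(2), of j] fun_cong[OF E, of j]
      by (cases "j < N") auto
    then show "\<alpha> = \<beta>" by (intro poly_mapping_eqI)
  qed
  moreover have "finite ((\<lambda>\<alpha>. restrict (Poly_Mapping.lookup \<alpha>) {..<N}) ` multiindices_below x)"
    by (rule finite_subset[of _ "PiE {..<N} (\<lambda>_. {0..int N})"])
       (use val in \<open>auto intro!: finite_PiE simp: PiE_iff extensional_def split: if_splits\<close>)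
  ultimately show ?thesis using finite_imageD by blast
qed

lemma cis_measurable:
  "(\<lambda>t. cis (2 * pi * t + a)) \<in> borel \<rightarrow>\<^sub>M restrict_space borel (sphere 0 1)"
  by (intro measurable_restrict_space2 borel_measurable_continuous_onI continuous_intros) auto

lemma sets_circle: "sets circle = sets (restrict_space borel (sphere 0 1))"
  and space_circle: "space circle = sphere 0 1"
  by (simp_all add: circle_def space_restrict_space)

lemma prob_space_circle: "prob_space circle"
  unfolding circle_def
proof (rule prob_space.prob_space_distr)
  show "prob_space (uniform_measure lborel {0..1::real})"
    by (rule prob_space_uniform_measure) auto
  show "(\<lambda>t. cis (2 * pi * t)) \<in> uniform_measure lborel {0..1} \<rightarrow>\<^sub>M restrict_space borel (sphere 0 1)"
    using cis_measurable[of 0] by simp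
qed

lemma prob_space_torus: "prob_space torus"
  unfolding torus_def by (intro prob_space_PiM prob_space_circle)

lemma space_torus: "space torus = {z. \<forall>j. norm (z j) = 1}"
  by (auto simp: torus_def space_PiM space_circle PiE_def Pi_def)

lemma emeasure_circle:
  assumes "A \<in> sets circle"
  shows "emeasure circle A = emeasure lborel ({0..1} \<inter> {t. cis (2 * pi * t) \<in> A})"
proof -
  have [measurable]: "{t. cis (2 * pi * t) \<in> A} \<in> sets borel"
    using measurable_sets[OF cis_measurable[of 0], of A] assms by (simp add: vimage_def sets_circle)
  have "emeasure circle A = emeasure (uniform_measure lborel {0..1::real}) {t. cis (2 * pi * t) \<in> A}"
    unfolding circle_def
    using cis_measurable[of 0] assms by (subst emeasure_distr) (auto simp: sets_circle vimage_def)
  also have "\<dots> = emeasure lborel ({0..1} \<inter> {t. cis (2 * pi * t) \<in> A})"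
    by (subst emeasure_uniform_measure) (auto simp: divide_ennreal_def)
  finally show ?thesis .
qed

lemma emeasure_lborel_shift:
  assumes "B \<in> sets borel"
  shows "emeasure lborel {t::real. t + s \<in> B} = emeasure lborel B"
proof -
  have "emeasure lborel B = emeasure (distr lborel borel ((+) s)) B"
    by (simp add: lborel_distr_plus)
  also have "\<dots> = emeasure lborel {t. t + s \<in> B}"
    using assms by (subst emeasure_distr) (auto simp: vimage_def add.commute)
  finally show ?thesis by simp
qed

lemma circle_translation:
  assumes w: "norm w = 1"
  shows "distr circle circle (\<lambda>z. w * z) = circle"
proof -
  obtain s where s: "0 \<le> s" "s < 1" "w = cis (2 * pi * s)"
  proof -
    obtain a where a: "0 \<le> a" "a < 2 * pi" "w = cis a"
      using w Arg2pi_ge_0[of w] Arg2pi_lt_2pi[of w] complex_norm_eq_1_exp[of w]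
      by (metis cis_conv_exp)
    show thesis by (rule that[of "a / (2 * pi)"]) (use a in auto)
  qed
  have m: "(\<lambda>z. w * z) \<in> circle \<rightarrow>\<^sub>M circle"
  proof -
    have "(\<lambda>z. w * z) \<in> restrict_space borel (sphere 0 1) \<rightarrow>\<^sub>M restrict_space borel (sphere 0 1)"
      using w by (intro measurable_restrict_space2 measurable_restrict_space1)
                 (auto simp: space_restrict_space norm_mult)
    then show ?thesis by (simp add: measurable_cong_sets[OF sets_circle sets_circle])
  qed
  show ?thesis
  proof (rule measure_eqI)
    fix A assume "A \<in> sets (distr circle circle (\<lambda>z. w * z))"
    then have A: "A \<in> sets circle" by simp
    define B where "B = {t. cis (2 * pi * t) \<in> A}"
    have B[measurable]: "B \<in> sets borel"
      using measurable_sets[OF cis_measurable[of 0], of A] A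
      by (simp add: vimage_def sets_circle B_def)
    have per: "t + 1 \<in> B \<longleftrightarrow> t \<in> B" for t
      by (simp add: B_def distrib_left cis_mult[symmetric])
    have "emeasure (distr circle circle (\<lambda>z. w * z)) A
        = emeasure circle ((\<lambda>z. w * z) -` A \<inter> space circle)"
      using m A by (rule emeasure_distr)
    also have "\<dots> = emeasure lborel ({0..1} \<inter> {t. cis (2 * pi * t) \<in> (\<lambda>z. w * z) -` A \<inter> space circle})"
      by (rule emeasure_circle[OF measurable_sets[OF m A]])
    also have "{0..1} \<inter> {t. cis (2 * pi * t) \<in> (\<lambda>z. w * z) -` A \<inter> space circle}
        = {t. t + s \<in> {s..s + 1} \<inter> B}"
      by (auto simp: space_circle s(3) cis_mult B_def distrib_left add.commute)
    also have "emeasure lborel \<dots> = emeasure lborel ({s..s + 1} \<inter> B)"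
      by (rule emeasure_lborel_shift) measurable
    also have "\<dots> = emeasure lborel ({s..1} \<inter> B) + emeasure lborel ({1<..s + 1} \<inter> B)"
      using s by (subst plus_emeasure) (auto intro!: arg_cong[where f = "emeasure lborel"])
    also have "emeasure lborel ({1<..s + 1} \<inter> B) = emeasure lborel {t. t + 1 \<in> {1<..s + 1} \<inter> B}"
      by (rule emeasure_lborel_shift[symmetric]) measurable
    also have "{t. t + 1 \<in> {1<..s + 1} \<inter> B} = {0<..s} \<inter> B"
      using per by auto
    also have "emeasure lborel ({0<..s} \<inter> B) = emeasure lborel ({0..<s} \<inter> B)"
    proof (rule emeasure_eq_AE)
      show "AE t in lborel. t \<in> {0<..s} \<inter> B \<longleftrightarrow> t \<in> {0..<s} \<inter> B"
        using AE_lborel_singleton[of 0] AE_lborel_singleton[of s] by eventually_elim auto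
    qed auto
    also have "emeasure lborel ({s..1} \<inter> B) + \<dots> = emeasure lborel ({0..1} \<inter> B)"
      using s by (subst plus_emeasure) (auto intro!: arg_cong[where f = "emeasure lborel"])
    also have "\<dots> = emeasure circle A"
      by (simp add: emeasure_circle[OF A] B_def)
    finally show "emeasure (distr circle circle (\<lambda>z. w * z)) A = emeasure circle A" .
  qed simp
qed

lemma torus_translation:
  assumes w: "w \<in> space torus"
  shows "distr torus torus (\<lambda>z j. w j * z j) = torus"
proof -
  have w1: "norm (w j) = 1" for j using w by (simp add: space_torus)
  interpret product_prob_space "\<lambda>_. circle" UNIV
    by (simp add: product_prob_spaceI prob_space_circle)
  have mj: "(\<lambda>z. w j * z) \<in> circle \<rightarrow>\<^sub>M circle" for j
  proof -
    have "(\<lambda>z. w j * z) \<in> restrict_space borel (sphere 0 1) \<rightarrow>\<^sub>M restrict_space borel (sphere 0 1)"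
      using w1[of j] by (intro measurable_restrict_space2 measurable_restrict_space1)
                 (auto simp: space_restrict_space norm_mult)
    then show ?thesis by (simp add: measurable_cong_sets[OF sets_circle sets_circle])
  qed
  have m: "(\<lambda>z j. w j * z j) \<in> torus \<rightarrow>\<^sub>M torus"
    unfolding torus_def
  proof (rule measurable_PiM_single')
    fix j show "(\<lambda>z. w j * z j) \<in> PiM UNIV (\<lambda>_. circle) \<rightarrow>\<^sub>M circle"
      by (rule measurable_compose[OF _ mj[of j]]) (simp add: measurable_component_singleton)
  qed (use w1 in \<open>auto simp: space_PiM space_circle norm_mult PiE_def Pi_def\<close>)
  have "distr torus torus (\<lambda>z j. w j * z j) = PiM UNIV (\<lambda>_. circle)"
  proof (rule PiM_eq)
    fix J :: "nat set" and F
    assume J: "finite J" and F: "\<And>j. j \<in> J \<Longrightarrow> F j \<in> sets circle"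
    let ?G = "\<lambda>j. (\<lambda>z. w j * z) -` F j \<inter> space circle"
    have emb: "prod_emb UNIV (\<lambda>_. circle) J (Pi\<^sub>E J F) \<in> sets torus"
      unfolding torus_def using J F by (intro sets_PiM_I) auto
    have G: "?G j \<in> sets circle" if "j \<in> J" for j
      using measurable_sets[OF mj F[OF that]] .
    have "emeasure (distr torus torus (\<lambda>z j. w j * z j)) (prod_emb UNIV (\<lambda>_. circle) J (Pi\<^sub>E J F))
        = emeasure torus ((\<lambda>z j. w j * z j) -` prod_emb UNIV (\<lambda>_. circle) J (Pi\<^sub>E J F) \<inter> space torus)"
      by (rule emeasure_distr[OF m emb])
    also have "(\<lambda>z j. w j * z j) -` prod_emb UNIV (\<lambda>_. circle) J (Pi\<^sub>E J F) \<inter> space torus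
        = prod_emb UNIV (\<lambda>_. circle) J (Pi\<^sub>E J ?G)"
      using w1 by (auto simp: prod_emb_iff space_torus space_circle norm_mult PiE_iff)
    also have "emeasure torus \<dots> = (\<Prod>j\<in>J. emeasure circle (?G j))"
      unfolding torus_def using J G by (intro emeasure_PiM_emb) auto
    also have "\<dots> = (\<Prod>j\<in>J. emeasure circle (F j))"
    proof (rule prod.cong[OF refl])
      fix j assume j: "j \<in> J"
      have "emeasure circle (?G j) = emeasure (distr circle circle (\<lambda>z. w j * z)) (F j)"
        using mj F[OF j] by (rule emeasure_distr[symmetric])
      then show "emeasure circle (?G j) = emeasure circle (F j)"
        by (simp add: circle_translation[OF w1])
    qed
    finally show "emeasure (distr torus torus (\<lambda>z j. w j * z j)) (prod_emb UNIV (\<lambda>_. circle) J (Pi\<^sub>E J F))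
        = (\<Prod>j\<in>J. emeasure circle (F j))" .
  qed (simp add: torus_def)
  then show ?thesis by (simp add: torus_def)
qed

end

theory Submission
  imports Defs
begin

text \<open>On an integrable function whose spectrum lies in the nonnegative multiindices, the Riesz mean
  of length \<open>x\<close> acts as a convolution along the Kronecker flow
  \<open>(z\<^sub>j) \<mapsto> (p\<^sub>j\<^sup>i\<^sup>t z\<^sub>j)\<close> with the dilate by \<open>x\<close> of the kernel whose Fourier transform is
  \<open>max 0 (1 - \<bar>u\<bar>) powr k\<close>; the values of this multiplier at negative \<open>u\<close> are irrelevant, which is why the
  even extension may be chosen.  Integrating by parts twice, this kernel is
  \<open>O(\<bar>t\<bar> powr -(1 + min k 1))\<close>, so it is dominated by a convergent series of normalized indicators of
  dyadic intervals, and the maximal function of the means is controlled by the ergodic maximal function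
  of the flow.  The latter is of weak type (1,1) by Garsia's maximal ergodic argument applied to the
  time-\<open>h\<close> map with \<open>h\<close> tending to 0.  Trigonometric polynomials are dense in \<open>L\<^sup>1\<close> and for them the
  convergence is evident.  Only rational \<open>x\<close> matter, because the means are continuous in \<open>x\<close>.\<close>

section \<open>Fourier inversion on the real line\<close>

text \<open>Along the flow the character z^\<alpha> oscillates with frequency log p^\<alpha>, so the
  logarithmic ordering of the sum becomes a one-variable cut-off on each orbit, and invariance of
  the measure turns bounds on orbits into bounds free of the dimension. Uniqueness of Fourier
  coefficients identifies a Riesz mean with a flow convolution only off a null set that depends on
  \<open>x\<close>; this is what makes the restriction to countably many \<open>x\<close> essential.
  The polynomials approximating \<open>f\<close> may have frequencies of either sign, so their Riesz
  means need not be their flow convolutions. The comparison therefore takes place between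
  convolutions, and the spectrum of \<open>f\<close> is used only to replace its mean by its
  convolution. The exponent 1 + min k 1 reflects two defects of the multiplier: the behaviour v^k at
  distance v from the ends of its support, and the corner of the even extension at 0.\<close>

lemma integral_cis_std_normal_density:
  assumes "\<sigma> > 0"
  shows "(LINT t|lborel. cis (a * t) * complex_of_real (std_normal_density (\<sigma> * t)))
    = complex_of_real (sqrt (2 * pi) / \<sigma> * std_normal_density (a / \<sigma>))"
proof -
  have "complex_of_real (exp (- ((a / \<sigma>)\<^sup>2) / 2)) = char std_normal_distribution (a / \<sigma>)"
    by (simp add: char_std_normal_distribution)
  also have "\<dots> = (LINT s|lborel. std_normal_density s *\<^sub>R iexp (a / \<sigma> * s))"
    unfolding char_def by (subst integral_density) auto
  also have "\<dots> = \<sigma> *\<^sub>R (LINT t|lborel. std_normal_density (0 + \<sigma> * t) *\<^sub>R iexp (a / \<sigma> * (0 + \<sigma> * t)))"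
    using assms by (subst lborel_integral_real_affine[of \<sigma> _ 0]) auto
  also have "(LINT t|lborel. std_normal_density (0 + \<sigma> * t) *\<^sub>R iexp (a / \<sigma> * (0 + \<sigma> * t)))
     = (LINT t|lborel. cis (a * t) * complex_of_real (std_normal_density (\<sigma> * t)))"
    using assms by (intro Bochner_Integration.integral_cong) (auto simp: cis_conv_exp scaleR_conv_of_real)
  finally have "complex_of_real (exp (- ((a / \<sigma>)\<^sup>2) / 2)) / \<sigma> =
      (LINT t|lborel. cis (a * t) * complex_of_real (std_normal_density (\<sigma> * t)))"
    using assms by (simp add: scaleR_conv_of_real)
  then show ?thesis
    by (simp add: std_normal_density_def flip: of_real_divide)
qed

lemma std_normal_density_bounded: "std_normal_density x \<le> std_normal_density 0"
  by (simp add: std_normal_density_def divide_right_mono)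

text \<open>Gaussian summation: a factor \<open>std_normal_density (s * t)\<close> is inserted on
  the transform side, and Fubini turns it into a Gaussian average of \<open>\<phi>\<close> around
  \<open>u\<close> at scale \<open>s\<close>. Both sides converge as \<open>s\<close> tends to 0,
  dominated by a multiple of |\<open>\<psi>\<close>| and of the Gaussian respectively, and limits
  are unique.\<close>

lemma fourier_inversion:
  fixes \<phi> :: "real \<Rightarrow> complex"
  defines "\<psi> \<equiv> \<lambda>t. LINT v|lborel. \<phi> v * cis (- (v * t))"
  assumes int[measurable]: "integrable lborel \<phi>"
    and cont: "continuous_on UNIV \<phi>" and bnd: "\<And>v. norm (\<phi> v) \<le> B"
    and int': "integrable lborel \<psi>"
  shows "(LINT t|lborel. \<psi> t * cis (u * t)) = 2 * pi * \<phi> u"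
proof -
  let ?n = std_normal_density
  define S where "S = sqrt (2 * pi)"
  have S: "S > 0" by (simp add: S_def)
  define \<sigma> where "\<sigma> n = 1 / real (Suc n)" for n
  have \<sigma>: "\<sigma> n > 0" for n by (simp add: \<sigma>_def)
  have \<sigma>0: "\<sigma> \<longlonglongrightarrow> 0" unfolding \<sigma>_def using LIMSEQ_inverse_real_of_nat by (simp add: inverse_eq_divide)
  have ncont: "isCont ?n x" for x unfolding std_normal_density_def by (intro continuous_intros) auto
  have [measurable]: "\<phi> \<in> borel_measurable borel" "\<psi> \<in> borel_measurable borel"
    using int int' by auto
  have cism[measurable]: "cis \<in> borel_measurable borel"
    by (intro borel_measurable_continuous_onI continuous_intros)
  have n_int: "integrable lborel (\<lambda>t. ?n (s * t))" if "s > 0" for s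
    using lborel_integrable_real_affine[OF integrable_std_normal_moment[of 0], of s 0] that by simp
  have A: "(LINT t|lborel. \<psi> t * cis (u * t) * ?n (s * t)) = sqrt (2 * pi) * (LINT r|lborel. \<phi> (u + s * r) * ?n r)"
    if s: "s > 0" for s
  proof -
    \<comment> \<open>The Gaussian supplies the integrability in \<open>t\<close>; without it the
      integrand has constant modulus in \<open>t\<close> and Fubini does not apply.\<close>
    have I: "integrable (lborel \<Otimes>\<^sub>M lborel) (\<lambda>(t, v). \<phi> v * cis (- (v * t)) * cis (u * t) * ?n (s * t))"
    proof (rule lborel_pair.Fubini_integrable)
      have "(\<lambda>t. LINT v|lborel. norm (\<phi> v * cis (- (v * t)) * cis (u * t) * ?n (s * t)))
          = (\<lambda>t. (LINT v|lborel. norm (\<phi> v)) * ?n (s * t))"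
        by (simp add: norm_mult)
      then show "integrable lborel (\<lambda>t. LINT v|lborel. norm (case (t, v) of (t, v) \<Rightarrow> \<phi> v * cis (- (v * t)) * cis (u * t) * ?n (s * t)))"
        using n_int[OF s] by simp
      have "integrable lborel (\<lambda>v. \<phi> v * cis (- (v * t)))" for t
        by (rule Bochner_Integration.integrable_bound[OF int]) (auto simp: norm_mult)
      then show "AE t in lborel. integrable lborel (\<lambda>v. case (t, v) of (t, v) \<Rightarrow> \<phi> v * cis (- (v * t)) * cis (u * t) * ?n (s * t))"
        by simp
    qed measurable
    have "(LINT t|lborel. \<psi> t * cis (u * t) * ?n (s * t))
        = (LINT t|lborel. LINT v|lborel. \<phi> v * cis (- (v * t)) * cis (u * t) * ?n (s * t))"
      unfolding \<psi>_def by simp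
    also have "\<dots> = (LINT v|lborel. LINT t|lborel. \<phi> v * cis (- (v * t)) * cis (u * t) * ?n (s * t))"
      by (rule lborel_pair.Fubini_integral[OF I, symmetric])
    also have "\<dots> = (LINT v|lborel. \<phi> v * (LINT t|lborel. cis ((u - v) * t) * ?n (s * t)))"
    proof (rule Bochner_Integration.integral_cong[OF refl])
      fix v
      have "(\<lambda>t. \<phi> v * cis (- (v * t)) * cis (u * t) * complex_of_real (?n (s * t)))
          = (\<lambda>t. \<phi> v * (cis ((u - v) * t) * complex_of_real (?n (s * t))))"
        by (auto simp: fun_eq_iff cis_mult mult.assoc algebra_simps)
      then show "(LINT t|lborel. \<phi> v * cis (- (v * t)) * cis (u * t) * ?n (s * t)) =
          \<phi> v * (LINT t|lborel. cis ((u - v) * t) * ?n (s * t))"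
        by simp
    qed
    also have "\<dots> = (LINT v|lborel. \<phi> v * complex_of_real (sqrt (2 * pi) / s * ?n ((u - v) / s)))"
      by (simp only: integral_cis_std_normal_density[OF s])
    also have "\<dots> = s *\<^sub>R (LINT r|lborel. \<phi> (u + s * r) * complex_of_real (sqrt (2 * pi) / s * ?n ((u - (u + s * r)) / s)))"
      using s by (subst lborel_integral_real_affine[of s _ u]) auto
    also have "\<dots> = (LINT r|lborel. sqrt (2 * pi) * (\<phi> (u + s * r) * ?n r))"
      unfolding integral_scaleR_right[symmetric]
      using s by (intro Bochner_Integration.integral_cong)
        (auto simp: scaleR_conv_of_real std_normal_density_def)
    finally show ?thesis by simp
  qed
  have "(\<lambda>n. LINT t|lborel. \<psi> t * cis (u * t) * ?n (\<sigma> n * t)) \<longlonglongrightarrow> (LINT t|lborel. \<psi> t * cis (u * t) * ?n 0)"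
  proof (rule integral_dominated_convergence)
    show "integrable lborel (\<lambda>t. norm (\<psi> t) * ?n 0)" using int' by simp
    show "AE t in lborel. (\<lambda>n. \<psi> t * cis (u * t) * ?n (\<sigma> n * t)) \<longlonglongrightarrow> \<psi> t * cis (u * t) * ?n 0"
    proof (intro AE_I2)
      fix t
      have "(\<lambda>n. \<sigma> n * t) \<longlonglongrightarrow> 0" using tendsto_mult_left_zero[OF \<sigma>0] by simp
      from isCont_tendsto_compose[OF ncont this]
      show "(\<lambda>n. \<psi> t * cis (u * t) * ?n (\<sigma> n * t)) \<longlonglongrightarrow> \<psi> t * cis (u * t) * ?n 0"
        by (intro tendsto_intros)
    qed
    show "AE t in lborel. norm (\<psi> t * cis (u * t) * ?n (\<sigma> n * t)) \<le> norm (\<psi> t) * ?n 0" for n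
      using std_normal_density_bounded by (auto simp: norm_mult intro!: mult_left_mono)
  qed measurable
  moreover have "(\<lambda>n. LINT t|lborel. \<psi> t * cis (u * t) * ?n (\<sigma> n * t)) \<longlonglongrightarrow> sqrt (2 * pi) * \<phi> u"
  proof -
    have "(\<lambda>n. LINT r|lborel. \<phi> (u + \<sigma> n * r) * ?n r) \<longlonglongrightarrow> (LINT r|lborel. \<phi> u * ?n r)"
    proof (rule integral_dominated_convergence)
      show "integrable lborel (\<lambda>r. B * ?n r)" using n_int[of 1] by simp
      show "AE r in lborel. (\<lambda>n. \<phi> (u + \<sigma> n * r) * ?n r) \<longlonglongrightarrow> \<phi> u * ?n r"
      proof (intro AE_I2)
        fix r
        have "(\<lambda>n. u + \<sigma> n * r) \<longlonglongrightarrow> u"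
          using tendsto_add[OF tendsto_const[of u] tendsto_mult_left_zero[OF \<sigma>0, of r]] by simp
        moreover have "isCont \<phi> u" using cont by (simp add: continuous_on_eq_continuous_at)
        ultimately have "(\<lambda>n. \<phi> (u + \<sigma> n * r)) \<longlonglongrightarrow> \<phi> u" by (intro isCont_tendsto_compose[of u \<phi>])
        then show "(\<lambda>n. \<phi> (u + \<sigma> n * r) * ?n r) \<longlonglongrightarrow> \<phi> u * ?n r"
          by (intro tendsto_intros)
      qed
      show "AE r in lborel. norm (\<phi> (u + \<sigma> n * r) * ?n r) \<le> B * ?n r" for n
        using bnd by (auto simp: norm_mult intro!: mult_right_mono)
    qed measurable
    also have "(LINT r|lborel. \<phi> u * ?n r) = \<phi> u * complex_of_real (LINT r|lborel. ?n r)"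
      using n_int[of 1] by (simp flip: of_real_mult)
    also have "(LINT r|lborel. ?n r) = 1" by simp
    finally show ?thesis unfolding A[OF \<sigma>] by (auto intro: tendsto_mult_left)
  qed
  ultimately have "(LINT t|lborel. \<psi> t * cis (u * t) * ?n 0) = sqrt (2 * pi) * \<phi> u"
    by (rule LIMSEQ_unique)
  \<comment> \<open>One factor sqrt(2 pi) comes from the transform of the Gaussian, the other from
    its value at 0; together they give 2 pi.\<close>
  moreover have "?n 0 = 1 / S" by (simp add: std_normal_density_def S_def)
  ultimately have "(LINT t|lborel. \<psi> t * cis (u * t)) / S = S * \<phi> u"
    unfolding S_def[symmetric] by simp
  then have "(LINT t|lborel. \<psi> t * cis (u * t)) = complex_of_real (S * S) * \<phi> u"
    using S by (simp add: field_simps)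
  moreover have "S * S = 2 * pi" by (simp add: S_def)
  ultimately show ?thesis by simp
qed

section \<open>The Riesz kernel\<close>

definition riesz_mult :: "real \<Rightarrow> real \<Rightarrow> real" where
  "riesz_mult k u = max 0 (1 - \<bar>u\<bar>) powr k"

text \<open>The inverse Fourier transform of the multiplier. Evenness permits the cosine form, which
  keeps the kernel real; for \<open>k = 1\<close> it is the Fejer kernel of the line.\<close>

definition riesz_kernel :: "real \<Rightarrow> real \<Rightarrow> real" where
  "riesz_kernel k t = (LINT u|lborel. riesz_mult k u * cos (u * t)) / (2 * pi)"

lemma riesz_mult_continuous:
  assumes "k > 0" shows "continuous_on A (riesz_mult k)"
  unfolding riesz_mult_def using assms by (intro continuous_on_powr' continuous_intros) auto

lemma riesz_mult_bounds:
  assumes "k > 0" shows "0 \<le> riesz_mult k u" "riesz_mult k u \<le> indicator {-1..1} u"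
proof -
  show "0 \<le> riesz_mult k u" by (simp add: riesz_mult_def)
  have "max 0 (1 - \<bar>u\<bar>) powr k \<le> 1 powr k" using assms by (intro powr_mono2) auto
  then show "riesz_mult k u \<le> indicator {-1..1} u"
    by (auto simp: riesz_mult_def indicator_def max_def)
qed

lemma riesz_mult_measurable: "k > 0 \<Longrightarrow> riesz_mult k \<in> borel_measurable borel"
  by (intro borel_measurable_continuous_onI riesz_mult_continuous)

lemma riesz_mult_integrable:
  assumes "k > 0" shows "integrable lborel (riesz_mult k)"
proof (rule Bochner_Integration.integrable_bound)
  show "integrable lborel (indicator {-1..1::real} :: real \<Rightarrow> real)" by simp
  show "riesz_mult k \<in> borel_measurable lborel" using riesz_mult_measurable[OF assms] by simp
  show "AE u in lborel. norm (riesz_mult k u) \<le> norm (indicator {-1..1} u :: real)"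
    using riesz_mult_bounds[OF assms] by simp
qed

lemma riesz_mult_cos_integrable:
  assumes "k > 0" shows "integrable lborel (\<lambda>u. riesz_mult k u * cos (u * t))"
proof (rule Bochner_Integration.integrable_bound[OF riesz_mult_integrable[OF assms]])
  have [measurable]: "riesz_mult k \<in> borel_measurable borel" by (rule riesz_mult_measurable[OF assms])
  show "(\<lambda>u. riesz_mult k u * cos (u * t)) \<in> borel_measurable lborel" by measurable
  show "AE u in lborel. norm (riesz_mult k u * cos (u * t)) \<le> norm (riesz_mult k u)"
    by (auto simp: abs_mult intro!: mult_left_le)
qed

lemma riesz_kernel_le_1:
  assumes "k > 0" shows "\<bar>riesz_kernel k t\<bar> \<le> 1"
proof -
  have "\<bar>LINT u|lborel. riesz_mult k u * cos (u * t)\<bar> \<le> (LINT u|lborel. indicator {-1..1::real} u)"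
  proof (rule integral_abs_bound_integral)
    show "\<bar>riesz_mult k u * cos (u * t)\<bar> \<le> indicator {-1..1} u" for u
      using riesz_mult_bounds[OF assms, of u] mult_mono[of "riesz_mult k u" "indicator {-1..1} u" "\<bar>cos (u * t)\<bar>" 1]
      by (simp add: abs_mult)
  qed (use riesz_mult_cos_integrable[OF assms] in auto)
  then show ?thesis using pi_gt3 by (simp add: riesz_kernel_def field_simps)
qed

lemma riesz_kernel_minus: "riesz_kernel k (- t) = riesz_kernel k t"
  by (simp add: riesz_kernel_def)

lemma riesz_kernel_complex:
  assumes k: "k > 0"
  shows "(LINT v|lborel. complex_of_real (riesz_mult k v) * cis (- (v * t))) = 2 * pi * complex_of_real (riesz_kernel k t)"
proof -
  have [measurable]: "riesz_mult k \<in> borel_measurable borel" by (rule riesz_mult_measurable[OF k])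
  have cism[measurable]: "cis \<in> borel_measurable borel"
    by (intro borel_measurable_continuous_onI continuous_intros)
  have int: "integrable lborel (\<lambda>v. complex_of_real (riesz_mult k v) * cis (v * s))" for s
    by (rule Bochner_Integration.integrable_bound[OF riesz_mult_integrable[OF k]]) (auto simp: norm_mult)
  have eq: "(LINT v|lborel. complex_of_real (riesz_mult k v) * cis (- (v * t)))
      = (LINT v|lborel. complex_of_real (riesz_mult k v) * cis (v * t))"
    by (subst lborel_integral_real_affine[of "-1" _ 0]) (auto simp: riesz_mult_def)
  have "2 * (LINT v|lborel. complex_of_real (riesz_mult k v) * cis (- (v * t)))
      = (LINT v|lborel. complex_of_real (riesz_mult k v) * cis (- (v * t)))
      + (LINT v|lborel. complex_of_real (riesz_mult k v) * cis (v * t))"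
    using eq by simp
  also have "\<dots> = (LINT v|lborel. complex_of_real (riesz_mult k v) * cis (- (v * t)) + complex_of_real (riesz_mult k v) * cis (v * t))"
    using int[of t] int[of "- t"] by simp
  also have "(\<lambda>v. complex_of_real (riesz_mult k v) * cis (- (v * t)) + complex_of_real (riesz_mult k v) * cis (v * t))
     = (\<lambda>v. complex_of_real (2 * (riesz_mult k v * cos (v * t))))"
    by (auto simp: fun_eq_iff complex_eq_iff)
  also have "(LINT v|lborel. complex_of_real (2 * (riesz_mult k v * cos (v * t)))) = complex_of_real (2 * (LINT v|lborel. riesz_mult k v * cos (v * t)))"
    by (subst integral_complex_of_real) simp
  finally show ?thesis by (simp add: riesz_kernel_def)
qed

text \<open>Evenness folds the line onto the half-line, and u = 1 - v moves the end of the support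
  to v = 0, so that the power v^k carries the whole singularity.\<close>

lemma riesz_kernel_eq_folded:
  assumes k: "k > 0"
  shows "riesz_kernel k t = (integral {0..1} (\<lambda>v. v powr k * cos ((1 - v) * t))) / pi"
proof -
  have [measurable]: "riesz_mult k \<in> borel_measurable borel" by (rule riesz_mult_measurable[OF k])
  let ?h = "\<lambda>u. riesz_mult k u * cos (u * t)"
  let ?g = "\<lambda>v. v powr k * cos ((1 - v) * t)"
  have int: "integrable lborel (\<lambda>u. indicator {0..1} u * ?h u)"
    using integrable_mult_indicator[OF _ riesz_mult_cos_integrable[OF k, of t], of "{0..1}"] by simp
  have int': "integrable lborel (\<lambda>u. indicator {0..1} (-u) * ?h (-u))"
    using lborel_integrable_real_affine[OF int, of "-1" 0] by simp
  have "(LINT u|lborel. ?h u) = (LINT u|lborel. indicator {0..1} u * ?h u + indicator {0..1} (-u) * ?h (-u))"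
  proof (rule integral_cong_AE)
    \<comment> \<open>At u = 0 both halves count the same value, so the splitting holds only off
      this point.\<close>
    show "AE u in lborel. ?h u = indicator {0..1} u * ?h u + indicator {0..1} (-u) * ?h (-u)"
      using AE_lborel_singleton[of 0]
    proof eventually_elim
      case (elim u)
      then show ?case by (auto simp: indicator_def riesz_mult_def max_def)
    qed
  qed measurable
  also have "\<dots> = (LINT u|lborel. indicator {0..1} u * ?h u) + (LINT u|lborel. indicator {0..1} (-u) * ?h (-u))"
    using int int' by simp
  also have "(LINT u|lborel. indicator {0..1} (-u) * ?h (-u)) = (LINT u|lborel. indicator {0..1} u * ?h u)"
    by (subst (2) lborel_integral_real_affine[of "-1" _ 0]) auto
  also have "(LINT u|lborel. indicator {0..1} u * ?h u) = (LINT v:{0..1}|lborel. ?g v)"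
    unfolding set_lebesgue_integral_def
    by (subst lborel_integral_real_affine[of "-1" _ 1])
       (auto simp: riesz_mult_def indicator_def intro!: Bochner_Integration.integral_cong)
  also have "\<dots> = integral {0..1} ?g"
    using k by (intro set_borel_integral_eq_integral borel_integrable_atLeastAtMost' continuous_on_mult
       continuous_on_powr' continuous_intros) auto
  finally show ?thesis by (simp add: riesz_kernel_def)
qed

text \<open>The cut at \<open>a\<close> = 1/t balances two estimates: on [0,a] the size of v^k gives
  a^(k+1), and on [a,1] two integrations by parts leave boundary terms and a remainder, each bounded
  by multiples of t^-2 and t^-(k+1). The slower of the two rates wins.\<close>

lemma riesz_kernel_decay:
  assumes k: "k > 0" and t: "t \<ge> 1"
  shows "\<bar>riesz_kernel k t\<bar> \<le> (2 + 4 * k) * t powr - (1 + min k 1)"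
proof -
  define a where "a = 1 / t"
  have a: "0 < a" "a \<le> 1" using t by (auto simp: a_def)
  let ?g = "\<lambda>v. v powr k * cos ((1 - v) * t)"
  let ?r = "\<lambda>v. v powr (k - 2) * cos ((1 - v) * t)"
  \<comment> \<open>Two integrations by parts condensed into one antiderivative: the sine terms
    cancel in its derivative, which leaves the integrand plus the remainder with v^(k-2).\<close>
  define H where "H v = - (v powr k * sin ((1 - v) * t)) / t + k / t\<^sup>2 * (v powr (k - 1) * cos ((1 - v) * t))" for v
  have gc: "continuous_on A ?g" if "A \<subseteq> {0..}" for A
    using k that by (intro continuous_on_mult continuous_on_powr' continuous_intros) auto
  have rc: "continuous_on {a..1} ?r"
    using a by (intro continuous_on_mult continuous_on_powr' continuous_intros) auto
  have "((\<lambda>v. ?g v + k * (k - 1) / t\<^sup>2 * ?r v) has_integral (H 1 - H a)) {a..1}"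
  proof (rule fundamental_theorem_of_calculus)
    fix v assume v: "v \<in> {a..1}"
    then have v0: "v > 0" using a by auto
    have p: "v powr (k - 1 - 1) = v powr (k - 2)" by simp
    show "(H has_vector_derivative ?g v + k * (k - 1) / t\<^sup>2 * ?r v) (at v within {a..1})"
      unfolding has_real_derivative_iff_has_vector_derivative[symmetric] H_def
      by (rule derivative_eq_intros refl v0 | use t v0 in \<open>simp add: powr_diff field_simps power2_eq_square\<close>)+
  qed (use a in auto)
  then have "integral {a..1} (\<lambda>v. ?g v + k * (k - 1) / t\<^sup>2 * ?r v) = H 1 - H a"
    by (rule integral_unique)
  moreover have ri0: "(\<lambda>v. k * (k - 1) / t\<^sup>2 * ?r v) integrable_on {a..1}"
    by (intro integrable_continuous_interval continuous_on_mult_left rc)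
  moreover have gi: "?g integrable_on {a..1}" "?g integrable_on {0..1}"
    using a by (auto intro!: integrable_continuous_interval gc)
  ultimately have FTC: "integral {a..1} ?g + k * (k - 1) / t\<^sup>2 * integral {a..1} ?r = H 1 - H a"
    by (simp only: Henstock_Kurzweil_Integration.integral_add[OF gi(1) ri0] integral_mult_right)
  \<comment> \<open>Keeping the factor |k - 1| and using the sign in the antiderivative avoids a
    division by k - 1, so \<open>k = 1\<close> is not a separate case.\<close>
  have ri: "((\<lambda>v. \<bar>k - 1\<bar> * v powr (k - 2)) has_integral (sgn (k - 1) * 1 powr (k - 1) - sgn (k - 1) * a powr (k - 1))) {a..1}"
  proof (rule fundamental_theorem_of_calculus)
    fix v assume v: "v \<in> {a..1}"
    then have v0: "v > 0" using a by auto
    show "((\<lambda>v. sgn (k - 1) * v powr (k - 1)) has_vector_derivative \<bar>k - 1\<bar> * v powr (k - 2)) (at v within {a..1})"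
      unfolding has_real_derivative_iff_has_vector_derivative[symmetric]
      by (rule derivative_eq_intros refl v0 | simp add: abs_sgn)+
  qed (use a in auto)
  have "\<bar>(k - 1) * integral {a..1} ?r\<bar> = norm (integral {a..1} (\<lambda>v. (k - 1) * ?r v))"
    by simp
  also have "\<dots> \<le> integral {a..1} (\<lambda>v. \<bar>k - 1\<bar> * v powr (k - 2))"
  proof (rule integral_norm_bound_integral)
    show "(\<lambda>v. (k - 1) * ?r v) integrable_on {a..1}"
      by (intro integrable_continuous_interval continuous_on_mult_left rc)
    show "(\<lambda>v. \<bar>k - 1\<bar> * v powr (k - 2)) integrable_on {a..1}"
      using ri by (rule has_integral_integrable)
    show "norm ((k - 1) * ?r v) \<le> \<bar>k - 1\<bar> * v powr (k - 2)" for v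
      by (auto simp: abs_mult intro!: mult_left_mono mult_left_le)
  qed
  also have "\<dots> = sgn (k - 1) * (1 - a powr (k - 1))" using integral_unique[OF ri] by (simp add: right_diff_distrib)
  also have "\<dots> \<le> 1 + a powr (k - 1)" by (auto simp: sgn_if)
  finally have "k / t\<^sup>2 * \<bar>(k - 1) * integral {a..1} ?r\<bar> \<le> k / t\<^sup>2 * (1 + a powr (k - 1))"
    using k by (intro mult_left_mono) auto
  moreover have "\<bar>k * (k - 1) / t\<^sup>2 * integral {a..1} ?r\<bar> = k / t\<^sup>2 * \<bar>(k - 1) * integral {a..1} ?r\<bar>"
    using k by (simp add: abs_mult)
  ultimately have R: "\<bar>k * (k - 1) / t\<^sup>2 * integral {a..1} ?r\<bar> \<le> k / t\<^sup>2 * (1 + a powr (k - 1))"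
    by (simp only:)
  have small: "\<bar>integral {0..a} ?g\<bar> \<le> a powr k * (a - 0)"
    unfolding real_norm_def[symmetric]
  proof (rule integral_bound)
    show "continuous_on {0..a} ?g" by (rule gc) auto
    show "norm (?g v) \<le> a powr k" if "v \<in> {0..a}" for v
    proof -
      have "norm (?g v) \<le> v powr k" by (simp add: abs_mult mult_left_le)
      also have "\<dots> \<le> a powr k" using that k by (intro powr_mono2) auto
      finally show ?thesis .
    qed
  qed (use a in simp)
  have split: "integral {0..1} ?g = integral {0..a} ?g + integral {a..1} ?g"
    using a gi by (intro Henstock_Kurzweil_Integration.integral_combine[symmetric]) auto
  have H1: "H 1 = k / t\<^sup>2" by (simp add: H_def)
  have Ha: "\<bar>H a\<bar> \<le> a powr k / t + k / t\<^sup>2 * a powr (k - 1)"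
  proof -
    have "\<bar>H a\<bar> \<le> \<bar>a powr k * sin ((1 - a) * t) / t\<bar> + \<bar>k / t\<^sup>2 * (a powr (k - 1) * cos ((1 - a) * t))\<bar>"
      using abs_triangle_ineq[of "- (a powr k * sin ((1 - a) * t) / t)" "k / t\<^sup>2 * (a powr (k - 1) * cos ((1 - a) * t))"]
      unfolding H_def minus_divide_left[symmetric] abs_minus_cancel .
    also have "\<dots> \<le> a powr k / t + k / t\<^sup>2 * a powr (k - 1)"
      using k t by (intro add_mono) (auto simp: abs_mult divide_right_mono mult_left_le intro!: mult_left_mono divide_right_mono)
    finally show ?thesis .
  qed
  have abs_aux: "\<bar>i\<bar> \<le> s + (h + b + r)"
    if "i = i0 + i1" "i1 + Q = h - ha" "\<bar>Q\<bar> \<le> r" "\<bar>i0\<bar> \<le> s" "\<bar>ha\<bar> \<le> b" "0 \<le> h"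
    for i i0 i1 Q h ha r s b :: real
    using that by linarith
  have "\<bar>integral {0..1} ?g\<bar> \<le> a powr k * a + (k / t\<^sup>2 + (a powr k / t + k / t\<^sup>2 * a powr (k - 1)) + k / t\<^sup>2 * (1 + a powr (k - 1)))"
    using k t by (intro abs_aux[OF split FTC[unfolded H1] R small[unfolded diff_0_right] Ha]) simp
  also have "\<dots> = 2 * a powr (k + 1) + 2 * k * (a powr 2 + a powr (k + 1))"
  proof -
    have "1 / t\<^sup>2 = a powr 2" using t by (simp add: a_def power_divide)
    moreover have "a powr k * a = a powr (k + 1)" using a by (simp add: powr_add)
    moreover have "a powr (k - 1) / t\<^sup>2 = a powr (k + 1)" 
      using a t by (simp add: a_def powr_diff powr_add power2_eq_square)
    moreover have "a powr k / t = a powr k * a" by (simp add: a_def)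
    ultimately show ?thesis by (simp add: algebra_simps divide_inverse)
  qed
  also have "\<dots> \<le> 2 * a powr (1 + min k 1) + 2 * k * (a powr (1 + min k 1) + a powr (1 + min k 1))"
  proof -
    \<comment> \<open>Since \<open>a\<close> is at most 1, the smaller exponent gives the larger
      power.\<close>
    have "1 + min k 1 \<le> k + 1" "1 + min k 1 \<le> 2" by linarith+
    then have "a powr (k + 1) \<le> a powr (1 + min k 1)" "a powr 2 \<le> a powr (1 + min k 1)"
      using a by (auto intro: powr_mono' simp del: powr_numeral)
    then show ?thesis using k by (intro add_mono mult_left_mono) auto
  qed
  also have "\<dots> = (2 + 4 * k) * t powr - (1 + min k 1)"
  proof -
    have "a powr (1 + min k 1) = t powr - (1 + min k 1)"
      using t unfolding a_def powr_minus_divide by (simp add: powr_divide)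
    then show ?thesis by (simp only: distrib_right distrib_left)
  qed
  finally have J: "\<bar>integral {0..1} ?g\<bar> \<le> (2 + 4 * k) * t powr - (1 + min k 1)" .
  have "\<bar>riesz_kernel k t\<bar> \<le> \<bar>integral {0..1} ?g\<bar>"
    using pi_gt3 by (simp add: riesz_kernel_eq_folded[OF k] abs_divide divide_le_eq mult_le_cancel_left1)
  with J show ?thesis by simp
qed

text \<open>With |t| of order 2^m, the decay |t|^-(1+d) splits into 2^-m, which normalizes the
  indicator of [-2^m, 2^m], and q^m with q = 2^-d, which is summable. One suitable \<open>m\<close>
  per \<open>t\<close> suffices, because a series of nonnegative terms dominates each of
  them.\<close>

lemma riesz_kernel_dyadic_bound:
  assumes k: "k > 0"
  obtains C q where "0 < C" "0 < q" "q < 1"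
    "\<And>t. \<exists>m::nat. \<bar>t\<bar> \<le> 2 ^ m \<and> \<bar>riesz_kernel k t\<bar> \<le> C * q ^ m / 2 ^ m"
proof (rule that)
  let ?d = "min k 1"
  show "0 < 4 * (2 + 4 * k)" "0 < 2 powr - ?d" "2 powr - ?d < 1"
    using k powr_less_mono[of "- ?d" 0 2] by auto
  fix t :: real
  show "\<exists>m::nat. \<bar>t\<bar> \<le> 2 ^ m \<and> \<bar>riesz_kernel k t\<bar> \<le> 4 * (2 + 4 * k) * (2 powr - ?d) ^ m / 2 ^ m"
  proof (cases "\<bar>t\<bar> \<le> 1")
    case True
    then show ?thesis using riesz_kernel_le_1[OF k, of t] k by (intro exI[of _ 0]) auto
  next
    case False
    define s where "s = \<bar>t\<bar>"
    have s: "s > 1" using False by (simp add: s_def)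
    define m where "m = nat \<lceil>log 2 s\<rceil>"
    have m: "real m = of_int \<lceil>log 2 s\<rceil>" using s by (simp add: m_def)
    have le: "s \<le> 2 powr m" using s m by (subst log_le_iff[symmetric]) (auto simp: le_of_int_ceiling)
    have ge: "2 powr (real m - 1) \<le> s"
      using s m le_log_iff[of 2 s "real m - 1"] of_int_ceiling_le_add_one[of "log 2 s"] by simp
    have "riesz_kernel k t = riesz_kernel k s"
      using riesz_kernel_minus[of k t] by (auto simp: s_def abs_if)
    also have "\<bar>\<dots>\<bar> \<le> (2 + 4 * k) * s powr - (1 + ?d)"
      by (rule riesz_kernel_decay) (use k s in auto)
    also have "\<dots> \<le> (2 + 4 * k) * (2 powr (real m - 1)) powr - (1 + ?d)"
      using k ge by (intro mult_left_mono powr_mono2') auto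
    also have "(2 powr (real m - 1)) powr - (1 + ?d) = 2 powr (1 + ?d) * ((2 powr - ?d) ^ m / 2 ^ m)"
    proof -
      have "(2 powr - ?d) ^ m = 2 powr (- ?d * m)" by (simp add: powr_powr flip: powr_realpow)
      moreover have "(2::real) ^ m = 2 powr m" by (simp add: powr_realpow)
      ultimately show ?thesis
        by (simp only: powr_powr powr_diff[symmetric] powr_add[symmetric]) (simp add: algebra_simps)
    qed
    \<comment> \<open>Replacing |t| by 2^(m-1) costs 2^(1+d), and d is at most 1; this is the origin
      of the factor 4.\<close>
    also have "(2 + 4 * k) * (2 powr (1 + ?d) * ((2 powr - ?d) ^ m / 2 ^ m))
        \<le> (2 + 4 * k) * (2 powr 2 * ((2 powr - ?d) ^ m / 2 ^ m))"
      using k by (intro mult_left_mono mult_right_mono powr_mono) auto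
    also have "\<dots> = 4 * (2 + 4 * k) * (2 powr - ?d) ^ m / 2 ^ m" by simp
    finally show ?thesis using le by (intro exI[of _ m]) (auto simp: s_def powr_realpow)
  qed
qed

text \<open>Each dyadic interval contributes at most C q^m N, and the geometric series sums to
  C/(1-q). The lemma serves twice: with \<open>G\<close> constant it gives integrability of the
  kernel, with \<open>G\<close> the modulus of a function along an orbit it gives the maximal
  bound.\<close>

lemma dyadic_kernel_nn_integral_le:
  fixes K :: "real \<Rightarrow> real" and C q :: real
  assumes K: "\<And>t. \<exists>m::nat. \<bar>t\<bar> \<le> 2 ^ m \<and> \<bar>K t\<bar> \<le> C * q ^ m / 2 ^ m"
    and C: "0 < C" "0 < q" "q < 1"
    and G[measurable]: "G \<in> borel_measurable borel"
    and N: "\<And>m::nat. (\<integral>\<^sup>+t\<in>{- (2 ^ m)..2 ^ m}. G t \<partial>lborel) \<le> 2 ^ m * N"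
  shows "(\<integral>\<^sup>+t. ennreal \<bar>K t\<bar> * G t \<partial>lborel) \<le> ennreal (C / (1 - q)) * N"
proof -
  have "(\<integral>\<^sup>+t. ennreal \<bar>K t\<bar> * G t \<partial>lborel)
      \<le> (\<integral>\<^sup>+t. (suminf (\<lambda>m. ennreal (C * q ^ m / 2 ^ m) * (G t * indicator {- (2 ^ m)..2 ^ m} t))) \<partial>lborel)"
  proof (rule nn_integral_mono)
    fix t :: real
    obtain m :: nat where m: "\<bar>t\<bar> \<le> 2 ^ m" "\<bar>K t\<bar> \<le> C * q ^ m / 2 ^ m" using K[of t] by blast
    have "ennreal \<bar>K t\<bar> * G t \<le> ennreal (C * q ^ m / 2 ^ m) * (G t * indicator {- (2 ^ m)..2 ^ m} t)"
      using m by (auto simp: indicator_def intro!: mult_right_mono ennreal_leI)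
    also have "\<dots> = (\<Sum>i\<in>{m}. ennreal (C * q ^ i / 2 ^ i) * (G t * indicator {- (2 ^ i)..2 ^ i} t))" by simp
    also have "\<dots> \<le> (suminf (\<lambda>m. ennreal (C * q ^ m / 2 ^ m) * (G t * indicator {- (2 ^ m)..2 ^ m} t)))"
      by (rule sum_le_suminf) auto
    finally show "ennreal \<bar>K t\<bar> * G t \<le> (suminf (\<lambda>m. ennreal (C * q ^ m / 2 ^ m) * (G t * indicator {- (2 ^ m)..2 ^ m} t)))" .
  qed
  also have "\<dots> = (suminf (\<lambda>m. ennreal (C * q ^ m / 2 ^ m) * (\<integral>\<^sup>+t\<in>{- (2 ^ m)..2 ^ m}. G t \<partial>lborel)))"
    by (subst nn_integral_suminf) (auto simp: nn_integral_cmult)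
  also have "\<dots> \<le> (suminf (\<lambda>m. ennreal (C * q ^ m / 2 ^ m) * (ennreal (2 ^ m) * N)))"
    using N by (intro suminf_le mult_left_mono) (auto simp flip: ennreal_power)
  also have "\<dots> = (suminf (\<lambda>m. ennreal (C * q ^ m) * N))"
    using C by (simp flip: mult.assoc ennreal_mult)
  also have "\<dots> = (suminf (\<lambda>m. ennreal (C * q ^ m))) * N" by simp
  also have "suminf (\<lambda>m. ennreal (C * q ^ m)) = ennreal (suminf (\<lambda>m. C * q ^ m))"
    using C by (intro suminf_ennreal2) (auto intro!: summable_mult summable_geometric)
  also have "(suminf (\<lambda>m. C * q ^ m)) = C / (1 - q)"
    using C by (subst suminf_mult) (auto intro!: summable_geometric simp: suminf_geometric)
  finally show ?thesis .
qed

lemma riesz_kernel_measurable: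
  assumes k: "k > 0" shows "riesz_kernel k \<in> borel_measurable borel"
proof -
  have [measurable]: "riesz_mult k \<in> borel_measurable borel" by (rule riesz_mult_measurable[OF k])
  show ?thesis unfolding riesz_kernel_def[abs_def] by measurable
qed

lemma riesz_kernel_integrable:
  assumes k: "k > 0" shows "integrable lborel (riesz_kernel k)"
proof -
  obtain C q where C: "0 < C" "0 < q" "q < 1"
    "\<And>t. \<exists>m::nat. \<bar>t\<bar> \<le> 2 ^ m \<and> \<bar>riesz_kernel k t\<bar> \<le> C * q ^ m / 2 ^ m"
    using riesz_kernel_dyadic_bound[OF k] by metis
  have "(\<integral>\<^sup>+t. ennreal \<bar>riesz_kernel k t\<bar> * 1 \<partial>lborel) \<le> ennreal (C / (1 - q)) * 2"
  proof (rule dyadic_kernel_nn_integral_le[OF C(4,1-3)])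
    show "(\<integral>\<^sup>+t\<in>{- (2 ^ m)..2 ^ m::real}. 1 \<partial>lborel) \<le> 2 ^ m * 2" for m :: nat
    proof -
      have "(\<integral>\<^sup>+t\<in>{- (2 ^ m)..2 ^ m::real}. 1 \<partial>lborel) = ennreal (2 ^ m * 2)" by simp
      also have "\<dots> = 2 ^ m * 2" by (simp add: ennreal_mult flip: ennreal_power)
      finally show ?thesis by simp
    qed
  qed simp
  also have "\<dots> < \<infinity>" by (simp add: ennreal_mult_less_top)
  finally show ?thesis
    using riesz_kernel_measurable[OF k] by (intro integrableI_bounded) auto
qed

text \<open>Inversion applied to the multiplier. Its hypothesis that the transform be integrable is
  where the decay of the kernel pays off.\<close>

lemma fourier_riesz_kernel:
  assumes k: "k > 0"
  shows "(LINT t|lborel. complex_of_real (riesz_kernel k t) * cis (u * t)) = riesz_mult k u"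
proof -
  let ?\<phi> = "\<lambda>v. complex_of_real (riesz_mult k v)"
  have eq: "(\<lambda>t. LINT v|lborel. ?\<phi> v * cis (- (v * t))) = (\<lambda>t. 2 * pi * complex_of_real (riesz_kernel k t))"
    using riesz_kernel_complex[OF k] by (auto simp: fun_eq_iff)
  have "(LINT t|lborel. 2 * pi * complex_of_real (riesz_kernel k t) * cis (u * t)) = 2 * pi * ?\<phi> u"
    unfolding fun_cong[OF eq, symmetric]
  proof (rule fourier_inversion[where B = 1])
    show "complex_integrable lborel ?\<phi>" using riesz_mult_integrable[OF k] by simp
    show "continuous_on UNIV ?\<phi>" by (intro continuous_intros riesz_mult_continuous k)
    show "norm (?\<phi> v) \<le> 1" for v
      using riesz_mult_bounds[OF k, of v] by (cases "v \<in> {-1..1}") (auto simp: indicator_def)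
    show "complex_integrable lborel (\<lambda>t. LINT v|lborel. ?\<phi> v * cis (- (v * t)))"
      unfolding eq using riesz_kernel_integrable[OF k] by simp
  qed
  then show ?thesis by (simp add: mult.assoc)
qed

section \<open>Maximal inequalities for measure-preserving flows\<close>

text \<open>Garsia's recursion for the maximum of the ergodic sums of length at most \<open>n\<close>, the empty sum
  included.\<close>

primrec garsia_max :: "('a \<Rightarrow> 'a) \<Rightarrow> ('a \<Rightarrow> real) \<Rightarrow> nat \<Rightarrow> 'a \<Rightarrow> real" where
  "garsia_max T g 0 = (\<lambda>z. 0)"
| "garsia_max T g (Suc n) = (\<lambda>z. max 0 (g z + garsia_max T g n (T z)))"

lemma garsia_max_nonneg: "0 \<le> garsia_max T g n z"
  by (cases n) auto

lemma garsia_max_mono_Suc: "garsia_max T g n z \<le> garsia_max T g (Suc n) z"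
proof (induction n arbitrary: z)
  case (Suc n)
  have "garsia_max T g (Suc n) z = max 0 (g z + garsia_max T g n (T z))" by simp
  also have "\<dots> \<le> max 0 (g z + garsia_max T g (Suc n) (T z))"
    using Suc[of "T z"] by linarith
  finally show ?case by simp
qed simp

lemma garsia_max_mono: "m \<le> n \<Longrightarrow> garsia_max T g m z \<le> garsia_max T g n z"
proof (induction n rule: dec_induct)
  case (step n)
  then show ?case using garsia_max_mono_Suc[of T g n z] by linarith
qed simp

lemma ergodic_sum_le_garsia_max: "(\<Sum>j<n. g ((T ^^ j) z)) \<le> garsia_max T g n z"
proof (induction n arbitrary: z)
  case (Suc n)
  have "(\<Sum>j<Suc n. g ((T ^^ j) z)) = g z + (\<Sum>j<n. g ((T ^^ j) (T z)))"
    by (subst sum.lessThan_Suc_shift) (simp add: funpow_swap1)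
  then show ?case using Suc[of "T z"] by simp
qed simp

section \<open>The maximal ergodic inequality for a single map\<close>

lemma integrable_comp_distr:
  fixes g :: "'a \<Rightarrow> 'b::{banach, second_countable_topology}"
  assumes T: "T \<in> M \<rightarrow>\<^sub>M M" and inv: "distr M M T = M" and g: "integrable M g"
  shows "integrable M (\<lambda>z. g (T z))" "(LINT z|M. g (T z)) = (LINT z|M. g z)"
proof -
  have g': "g \<in> borel_measurable M" using g by simp
  show "integrable M (\<lambda>z. g (T z))"
    using integrable_distr_eq[OF T g'] g by (simp add: inv)
  show "(LINT z|M. g (T z)) = (LINT z|M. g z)"
    using integral_distr[OF T g'] by (simp add: inv)
qed

lemma integrable_garsia_max:
  assumes T: "T \<in> M \<rightarrow>\<^sub>M M" and inv: "distr M M T = M" and g: "integrable M g"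
  shows "integrable M (garsia_max T g n)"
proof (induction n)
  case (Suc n)
  then show ?case
    using g integrable_comp_distr(1)[OF T inv Suc] by simp
qed simp

text \<open>Let F be the maximum. Where F > 0, the recursion and monotonicity in \<open>n\<close>
  give F \<le> g + F o T; elsewhere F = 0 \<le> F o T. Hence F - F o T is at most \<open>g\<close>
  restricted to the set, and its integral is 0 by invariance.\<close>

lemma maximal_ergodic:
  assumes T: "T \<in> M \<rightarrow>\<^sub>M M" and inv: "distr M M T = M" and g: "integrable M g"
  shows "0 \<le> (LINT z:{z \<in> space M. garsia_max T g n z > 0}|M. g z)"
proof (cases n)
  case (Suc m)
  let ?F = "garsia_max T g n" and ?E = "{z \<in> space M. garsia_max T g n z > 0}"
  have F: "integrable M ?F" by (rule integrable_garsia_max[OF T inv g])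
  note FT = integrable_comp_distr[OF T inv F]
  have [measurable]: "?F \<in> borel_measurable M" using F by simp
  have E: "?E \<in> sets M" by measurable
  have "0 = (LINT z|M. ?F z - ?F (T z))"
    using F FT by simp
  also have "\<dots> \<le> (LINT z|M. indicator ?E z *\<^sub>R g z)"
  proof (rule integral_mono)
    show "integrable M (\<lambda>z. ?F z - ?F (T z))" using F FT by simp
    show "integrable M (\<lambda>z. indicator ?E z *\<^sub>R g z)"
      using integrable_mult_indicator[OF E g] .
    fix z assume z: "z \<in> space M"
    show "?F z - ?F (T z) \<le> indicator ?E z *\<^sub>R g z"
    proof (cases "?F z > 0")
      case True
      then have "?F z = g z + garsia_max T g m (T z)" by (auto simp: Suc max_def split: if_splits)
      also have "garsia_max T g m (T z) \<le> ?F (T z)" using Suc garsia_max_mono[of m n] by simp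
      finally show ?thesis using True z by simp
    next
      case False
      then show ?thesis using garsia_max_nonneg[of T g n z] garsia_max_nonneg[of T g n "T z"] by simp
    qed
  qed
  finally show ?thesis by (simp add: set_lebesgue_integral_def)
qed (simp add: set_lebesgue_integral_def)

text \<open>The maximal inequality for h - c: an ergodic sum of \<open>h\<close> above c n is a
  positive ergodic sum of h - c. On the resulting set the integral of \<open>h\<close> is at least c
  times the measure, and \<open>h\<close> is nonnegative elsewhere.\<close>

lemma maximal_ergodic_weak_type_aux:
  fixes h :: "'a \<Rightarrow> real"
  assumes "finite_measure M" and T: "T \<in> M \<rightarrow>\<^sub>M M" and inv: "distr M M T = M" and h: "integrable M h"
    and h0: "\<And>z. 0 \<le> h z"
  shows "c * measure M {z \<in> space M. \<exists>n\<le>N. c * real n < (\<Sum>j<n. h ((T ^^ j) z))} \<le> (LINT z|M. h z)"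
proof (cases "c \<le> 0")
  case True
  then have "c * measure M {z \<in> space M. \<exists>n\<le>N. c * real n < (\<Sum>j<n. h ((T ^^ j) z))} \<le> 0"
    by (simp add: mult_nonpos_nonneg)
  also have "0 \<le> (LINT z|M. h z)" using h0 by simp
  finally show ?thesis .
next
  case False
  then have c: "c > 0" by simp
  interpret finite_measure M by fact
  define g where "g z = h z - c" for z
  have g: "integrable M g" unfolding g_def using h by simp
  let ?E = "{z \<in> space M. garsia_max T g N z > 0}"
  have [measurable]: "garsia_max T g N \<in> borel_measurable M" using integrable_garsia_max[OF T inv g] by simp
  have E: "?E \<in> sets M" by measurable
  have sub: "{z \<in> space M. \<exists>n\<le>N. c * real n < (\<Sum>j<n. h ((T ^^ j) z))} \<subseteq> ?E"
  proof safe
    fix z n assume "n \<le> N" "c * real n < (\<Sum>j<n. h ((T ^^ j) z))"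
    then have "0 < (\<Sum>j<n. g ((T ^^ j) z))" by (simp add: g_def sum_subtractf mult.commute)
    also have "\<dots> \<le> garsia_max T g n z" by (rule ergodic_sum_le_garsia_max)
    also have "\<dots> \<le> garsia_max T g N z" by (rule garsia_max_mono) fact
    finally show "0 < garsia_max T g N z" .
  qed
  have "c * measure M {z \<in> space M. \<exists>n\<le>N. c * real n < (\<Sum>j<n. h ((T ^^ j) z))} \<le> c * measure M ?E"
    using c by (intro mult_left_mono finite_measure_mono[OF sub E]) auto
  also have "\<dots> = (LINT z|M. indicator ?E z * c)" by simp
  also have "\<dots> \<le> (LINT z|M. indicator ?E z * h z)"
  proof -
    have "integrable M (\<lambda>z. indicator ?E z * h z)" using integrable_mult_indicator[OF E h] by simp
    moreover have "integrable M (\<lambda>z. indicator ?E z * c)"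
      using E by (intro integrable_mult_left integrable_real_indicator) (auto simp: less_top[symmetric])
    ultimately show ?thesis
      using maximal_ergodic[OF T inv g, of N] E
      by (simp add: set_lebesgue_integral_def g_def right_diff_distrib)
  qed
  also have "\<dots> \<le> (LINT z|M. h z)"
    using h h0 integrable_mult_indicator[OF E h] by (intro integral_mono) (auto simp: indicator_def)
  finally show ?thesis .
qed

text \<open>Preimages of null sets under the iterates are null, and there are countably many
  iterates; a function may thus be altered on a null set along entire orbits.\<close>

lemma AE_funpow:
  assumes T: "T \<in> M \<rightarrow>\<^sub>M M" and inv: "distr M M T = M" and P: "AE z in M. P z"
  shows "AE z in M. \<forall>j. P ((T ^^ j) z)"
proof -
  have "AE z in M. P ((T ^^ j) z)" for j
  proof (induction j)
    case (Suc j)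
    have "AE z in distr M M T. P ((T ^^ j) z)" unfolding inv by (rule Suc)
    from AE_distrD[OF T this] show ?case by (simp add: funpow_swap1)
  qed (use P in simp)
  then show ?thesis by (simp add: AE_all_countable)
qed

text \<open>If the integral is finite, \<open>h\<close> is finite almost everywhere and may be made
  real along orbits; continuity from below then removes the bound on the length. Values in
  \<open>ennreal\<close> suit the orbit integrals to which this is applied, which may be infinite at
  some points.\<close>

lemma maximal_ergodic_weak_type:
  fixes h :: "'a \<Rightarrow> ennreal"
  assumes fin: "finite_measure M" and T: "T \<in> M \<rightarrow>\<^sub>M M" and inv: "distr M M T = M"
    and h[measurable]: "h \<in> borel_measurable M"
    and c: "c > 0"
  shows "c * emeasure M {z \<in> space M. \<exists>n. c * of_nat n < (\<Sum>j<n. h ((T ^^ j) z))} \<le> (\<integral>\<^sup>+z. h z \<partial>M)"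
proof (cases "(\<integral>\<^sup>+z. h z \<partial>M) = \<infinity> \<or> c = \<infinity>")
  case True
  then show ?thesis
  proof
    assume c: "c = \<infinity>"
    \<comment> \<open>For n = 0 the condition reads 0 < 0, for n > 0 the left side is already
      infinite.\<close>
    have "{z \<in> space M. \<exists>n. c * of_nat n < (\<Sum>j<n. h ((T ^^ j) z))} = {}"
    proof safe
      fix z n assume "c * of_nat n < (\<Sum>j<n. h ((T ^^ j) z))"
      then show "z \<in> {}" using c by (cases "n = 0") (auto simp: ennreal_top_mult)
    qed
    then show ?thesis by (simp only: emeasure_empty mult_zero_right zero_le)
  qed simp
next
  case False
  interpret finite_measure M by fact
  have [measurable]: "(\<lambda>z. (T ^^ j) z) \<in> M \<rightarrow>\<^sub>M M" for j
    by (induction j) (use T in auto)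
  define h' where "h' z = enn2real (h z)" for z
  have fin_h: "AE z in M. h z \<noteq> \<infinity>" using False by (intro nn_integral_PInf_AE) auto
  then have eq: "AE z in M. \<forall>j. h ((T ^^ j) z) = ennreal (h' ((T ^^ j) z))"
    unfolding h'_def by (intro AE_funpow[OF T inv]) (auto simp: less_top)
  have "(\<integral>\<^sup>+z. h z \<partial>M) = (\<integral>\<^sup>+z. h' z \<partial>M)"
  proof (rule nn_integral_cong_AE)
    show "AE z in M. h z = ennreal (h' z)"
      using eq by eventually_elim (drule spec[of _ 0], simp)
  qed
  moreover have h'_int: "integrable M h'"
    using False calculation unfolding h'_def by (intro integrableI_nonneg) (auto simp: less_top)
  ultimately have int_eq: "(\<integral>\<^sup>+z. h z \<partial>M) = ennreal (LINT z|M. h' z)"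
    using nn_integral_eq_integral[OF h'_int] by (simp add: h'_def[abs_def])
  obtain r where r: "c = ennreal r" "r > 0" using c False by (cases c) auto
  define A where "A N = {z \<in> space M. \<exists>n\<le>N. r * real n < (\<Sum>j<n. h' ((T ^^ j) z))}" for N
  have [measurable]: "h' \<in> borel_measurable M" unfolding h'_def by measurable
  have A[measurable]: "A N \<in> sets M" for N unfolding A_def by measurable
  have "emeasure M {z \<in> space M. \<exists>n. c * of_nat n < (\<Sum>j<n. h ((T ^^ j) z))} = emeasure M (\<Union>N. A N)"
  proof (rule emeasure_eq_AE)
    show "AE z in M. (z \<in> {z \<in> space M. \<exists>n. c * of_nat n < (\<Sum>j<n. h ((T ^^ j) z))}) = (z \<in> (\<Union>N. A N))"
      using eq
    proof eventually_elim
      case (elim z)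
      have "(\<Sum>j<n. h ((T ^^ j) z)) = ennreal (\<Sum>j<n. h' ((T ^^ j) z))" for n
      proof -
        have "(\<Sum>j<n. h ((T ^^ j) z)) = (\<Sum>j<n. ennreal (h' ((T ^^ j) z)))"
          by (intro sum.cong refl) (rule elim[rule_format])
        then show ?thesis by (simp add: h'_def sum_ennreal)
      qed
      moreover have "c * of_nat n = ennreal (r * real n)" for n
        using r by (simp add: ennreal_mult ennreal_of_nat_eq_real_of_nat)
      moreover have "0 \<le> r * real n" for n using r by simp
      ultimately show ?case by (auto simp: A_def ennreal_less_iff)
    qed
  qed measurable
  also have "c * \<dots> = c * (SUP N. emeasure M (A N))"
    by (subst SUP_emeasure_incseq) (auto simp: incseq_def A_def intro: order_trans)
  also have "\<dots> = (SUP N. c * emeasure M (A N))" by (simp add: SUP_mult_left_ennreal)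
  also have "\<dots> \<le> (\<integral>\<^sup>+z. h z \<partial>M)"
  proof (rule SUP_least)
    fix N
    have "r * measure M (A N) \<le> (LINT z|M. h' z)"
      unfolding A_def by (rule maximal_ergodic_weak_type_aux[OF fin T inv h'_int]) (simp add: h'_def)
    then show "c * emeasure M (A N) \<le> (\<integral>\<^sup>+z. h z \<partial>M)"
      using r by (simp add: int_eq emeasure_eq_measure flip: ennreal_mult) (simp add: ennreal_leI)
  qed
  finally show ?thesis .
qed

section \<open>Weak type bound for the maximal function of a flow\<close>

locale measure_flow = prob_space M for M :: "'a measure" +
  fixes \<Phi> :: "real \<Rightarrow> 'a \<Rightarrow> 'a"
  \<comment> \<open>Measurability is joint in time and point, since orbit integrals are integrated
    over the space by Fubini.\<close>
  assumes flow_measurable: "(\<lambda>p. \<Phi> (fst p) (snd p)) \<in> borel \<Otimes>\<^sub>M M \<rightarrow>\<^sub>M M"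
    and flow_add: "\<And>z. z \<in> space M \<Longrightarrow> \<Phi> (s + t) z = \<Phi> s (\<Phi> t z)"
    and flow_0: "\<And>z. z \<in> space M \<Longrightarrow> \<Phi> 0 z = z"
    and flow_invariant: "distr M M (\<Phi> t) = M"
begin

lemma flow_measurable' [measurable (raw)]:
  assumes [measurable]: "f \<in> N \<rightarrow>\<^sub>M borel" "g \<in> N \<rightarrow>\<^sub>M M"
  shows "(\<lambda>x. \<Phi> (f x) (g x)) \<in> N \<rightarrow>\<^sub>M M"
proof -
  have "(\<lambda>x. (f x, g x)) \<in> N \<rightarrow>\<^sub>M borel \<Otimes>\<^sub>M M" by measurable
  from measurable_compose[OF this flow_measurable] show ?thesis by simp
qed

lemma flow_time_measurable: "\<Phi> t \<in> M \<rightarrow>\<^sub>M M"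
  by (rule flow_measurable'[of "\<lambda>_. t" M "\<lambda>z. z"]) auto

text \<open>Transfers estimates on forward orbits to backward orbits; the two-sided maximal function
  is treated in this way.\<close>

lemma reversed_flow: "measure_flow M (\<lambda>t. \<Phi> (- t))"
proof unfold_locales
  have "(\<lambda>p. \<Phi> (- fst p) (snd p)) \<in> borel \<Otimes>\<^sub>M M \<rightarrow>\<^sub>M M" by measurable
  then show "(\<lambda>p. \<Phi> (- fst p) (snd p)) \<in> borel \<Otimes>\<^sub>M M \<rightarrow>\<^sub>M M" .
  show "\<Phi> (- (s + t)) z = \<Phi> (- s) (\<Phi> (- t) z)" if "z \<in> space M" for s t z
    using flow_add[OF that, of "- s" "- t"] by simp
qed (use flow_0 flow_invariant in auto)

lemma flow_iterate: "z \<in> space M \<Longrightarrow> (\<Phi> h ^^ j) z = \<Phi> (real j * h) z"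
proof (induction j)
  case (Suc j)
  then show ?case using flow_add[of z h "real j * h"] by (simp add: distrib_right)
qed (simp add: flow_0)

lemma nn_integral_flow:
  assumes "G \<in> borel_measurable M"
  shows "(\<integral>\<^sup>+z. G (\<Phi> t z) \<partial>M) = (\<integral>\<^sup>+z. G z \<partial>M)"
  using nn_integral_distr[OF flow_time_measurable[of t], of G] assms by (simp add: flow_invariant)

end

text \<open>An inequality suffices later and lets the closed pieces overlap at their endpoints; only
  the degenerate interval for \<open>n = 0\<close> calls for a null set.\<close>

lemma nn_integral_interval_le_sum_shifts:
  fixes g :: "real \<Rightarrow> ennreal"
  assumes [measurable]: "g \<in> borel_measurable borel" and h: "h > 0"
  shows "(\<integral>\<^sup>+t\<in>{0..real n * h}. g t \<partial>lborel) \<le> (\<Sum>j<n. \<integral>\<^sup>+t\<in>{0..h}. g (t + real j * h) \<partial>lborel)"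
proof (induction n)
  case 0
  have "(\<integral>\<^sup>+t\<in>{0..0}. g t \<partial>lborel) = (\<integral>\<^sup>+t. 0 \<partial>(lborel :: real measure))"
  proof (rule nn_integral_cong_AE)
    show "AE t in lborel. g t * indicator {0..0} t = 0"
      using AE_lborel_singleton[of 0] by eventually_elim auto
  qed
  then show ?case by simp
next
  case (Suc n)
  have "(\<integral>\<^sup>+t\<in>{0..real (Suc n) * h}. g t \<partial>lborel)
     \<le> (\<integral>\<^sup>+t. g t * indicator {0..real n * h} t + g t * indicator {real n * h..real (Suc n) * h} t \<partial>lborel)"
    by (intro nn_integral_mono) (auto simp: indicator_def)
  also have "\<dots> = (\<integral>\<^sup>+t\<in>{0..real n * h}. g t \<partial>lborel) + (\<integral>\<^sup>+t\<in>{real n * h..real (Suc n) * h}. g t \<partial>lborel)"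
    by (rule nn_integral_add) auto
  also have "(\<integral>\<^sup>+t\<in>{real n * h..real (Suc n) * h}. g t \<partial>lborel)
     = (\<integral>\<^sup>+t. g (real n * h + 1 * t) * indicator {real n * h..real (Suc n) * h} (real n * h + 1 * t) \<partial>lborel)"
    by (subst nn_integral_real_affine[of _ 1 "real n * h"]) auto
  also have "\<dots> = (\<integral>\<^sup>+t\<in>{0..h}. g (t + real n * h) \<partial>lborel)"
    by (intro nn_integral_cong) (auto simp: indicator_def algebra_simps)
  finally show ?case using order_trans[OF _ add_right_mono[OF Suc]] by simp
qed

context measure_flow
begin

text \<open>With \<open>F\<close> the mean of \<open>G\<close> over the first \<open>h\<close> units
  of the orbit, h times an ergodic sum of \<open>F\<close> under the time-h map dominates the orbit
  integral of \<open>G\<close>. Rounding R/h up to an integer at most doubles it because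
  \<open>R\<close> is at least \<open>h\<close>; this costs the factor 2, uniformly in
  \<open>h\<close>.\<close>

lemma one_sided_weak_type_large:
  fixes c h :: real
  assumes G[measurable]: "G \<in> borel_measurable M" and c: "c > 0" and h: "h > 0"
  shows "ennreal c * emeasure M {z \<in> space M. \<exists>R\<in>{R\<in>\<rat>. h \<le> R}. ennreal (c * R) < (\<integral>\<^sup>+t\<in>{0..R}. G (\<Phi> t z) \<partial>lborel)}
    \<le> 2 * (\<integral>\<^sup>+z. G z \<partial>M)"
    (is "_ * emeasure M ?A \<le> _")
proof -
  define F where "F z = ennreal (1 / h) * (\<integral>\<^sup>+t\<in>{0..h}. G (\<Phi> t z) \<partial>lborel)" for z
  have [measurable]: "F \<in> borel_measurable M" unfolding F_def by measurable
  \<comment> \<open>Fubini and invariance: averaging over time preserves the integral over the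
    space.\<close>
  have "(\<integral>\<^sup>+z. \<integral>\<^sup>+t. G (\<Phi> t z) * indicator {0..h} t \<partial>lborel \<partial>M) = (\<integral>\<^sup>+t. \<integral>\<^sup>+z. G (\<Phi> t z) * indicator {0..h} t \<partial>M \<partial>lborel)"
  proof -
    interpret pair_sigma_finite M lborel ..
    show ?thesis by (rule Fubini'[symmetric]) measurable
  qed
  also have "\<dots> = (\<integral>\<^sup>+t. (\<integral>\<^sup>+z. G z \<partial>M) * indicator {0..h} t \<partial>lborel)"
    by (simp add: nn_integral_multc nn_integral_flow)
  also have "\<dots> = (\<integral>\<^sup>+z. G z \<partial>M) * ennreal h" using h by (simp add: nn_integral_cmult)
  finally have intF: "(\<integral>\<^sup>+z. F z \<partial>M) = (\<integral>\<^sup>+z. G z \<partial>M)"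
    using h unfolding F_def
    by (subst nn_integral_cmult) (auto simp: mult.left_commute simp flip: ennreal_mult)
  let ?B = "{z \<in> space M. \<exists>n. ennreal (c / 2) * of_nat n < (\<Sum>j<n. F ((\<Phi> h ^^ j) z))}"
  have T: "\<Phi> h \<in> M \<rightarrow>\<^sub>M M" by measurable
  have [measurable]: "(\<Phi> h ^^ j) \<in> M \<rightarrow>\<^sub>M M" for j
    by (induction j) (use T in \<open>auto simp: measurable_ident_sets intro!: measurable_comp\<close>)
  have "?A \<subseteq> ?B"
  proof safe
    fix z R assume z: "z \<in> space M" and R: "h \<le> R" and l: "ennreal (c * R) < (\<integral>\<^sup>+t\<in>{0..R}. G (\<Phi> t z) \<partial>lborel)"
    define n where "n = nat \<lceil>R / h\<rceil>"
    have n: "real n = of_int \<lceil>R / h\<rceil>" using R h by (simp add: n_def)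
    have n1: "R / h \<le> real n" "real n \<le> R / h + 1" unfolding n by linarith+
    have R1: "R \<le> real n * h" using n1(1) h by (simp add: field_simps)
    have "R / h \<ge> 1" using R h by simp
    then have R2: "real n \<le> 2 * (R / h)" using n1(2) by linarith
    have "(\<integral>\<^sup>+t\<in>{0..R}. G (\<Phi> t z) \<partial>lborel) \<le> (\<integral>\<^sup>+t\<in>{0..real n * h}. G (\<Phi> t z) \<partial>lborel)"
      using R1 by (intro nn_integral_mono) (auto simp: indicator_def)
    also have "\<dots> \<le> (\<Sum>j<n. \<integral>\<^sup>+t\<in>{0..h}. G (\<Phi> (t + real j * h) z) \<partial>lborel)"
      using z h by (intro nn_integral_interval_le_sum_shifts) auto
    also have "\<dots> = (\<Sum>j<n. ennreal h * F ((\<Phi> h ^^ j) z))"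
      using z h by (intro sum.cong refl)
        (simp add: F_def flow_iterate flow_add flip: mult.assoc ennreal_mult)
    also have "\<dots> = ennreal h * (\<Sum>j<n. F ((\<Phi> h ^^ j) z))" by (simp add: sum_distrib_left)
    finally have "ennreal (c * R) < ennreal h * (\<Sum>j<n. F ((\<Phi> h ^^ j) z))" using l by (rule order_less_le_trans[rotated])
    then have "ennreal (1 / h) * ennreal (c * R) < ennreal (1 / h) * (ennreal h * (\<Sum>j<n. F ((\<Phi> h ^^ j) z)))"
      using h by (intro ennreal_mult_strict_left_mono) auto
    then have "ennreal (c * (R / h)) < (\<Sum>j<n. F ((\<Phi> h ^^ j) z))"
      using h c R by (simp flip: mult.assoc ennreal_mult add: mult.commute)
    moreover have "ennreal (c / 2) * of_nat n \<le> ennreal (c * (R / h))"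
      using R2 c h by (simp add: ennreal_of_nat_eq_real_of_nat flip: ennreal_mult) (simp add: ennreal_leI field_simps)
    ultimately show "\<exists>n. ennreal (c / 2) * of_nat n < (\<Sum>j<n. F ((\<Phi> h ^^ j) z))"
      by (intro exI[of _ n]) (rule order_le_less_trans)
  qed
  moreover have "?B \<in> sets M" by measurable
  ultimately have "ennreal (c / 2) * emeasure M ?A \<le> ennreal (c / 2) * emeasure M ?B"
    by (intro mult_left_mono emeasure_mono) auto
  also have "\<dots> \<le> (\<integral>\<^sup>+z. F z \<partial>M)"
    by (rule maximal_ergodic_weak_type[OF _ T flow_invariant]) (use c finite_measure_axioms in auto)
  finally have "2 * (ennreal (c / 2) * emeasure M ?A) \<le> 2 * (\<integral>\<^sup>+z. G z \<partial>M)"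
    unfolding intF by (rule mult_left_mono) simp
  moreover have "2 * ennreal (c / 2) = ennreal c"
    using c by (simp add: ennreal_mult' flip: ennreal_numeral ennreal_mult)
  ultimately show ?thesis by (simp flip: mult.assoc)
qed

text \<open>The sets for radii at least 1/(n+1) increase to the set for all positive radii, and
  their common bound passes to the union.\<close>

lemma one_sided_weak_type:
  fixes c :: real
  assumes G[measurable]: "G \<in> borel_measurable M" and c: "c > 0"
  shows "{z \<in> space M. \<exists>R\<in>{R\<in>\<rat>. 0 < R}. ennreal (c * R) < (\<integral>\<^sup>+t\<in>{0..R}. G (\<Phi> t z) \<partial>lborel)} \<in> sets M" (is "?A \<in> _")
    and "ennreal c * emeasure M {z \<in> space M. \<exists>R\<in>{R\<in>\<rat>. 0 < R}. ennreal (c * R) < (\<integral>\<^sup>+t\<in>{0..R}. G (\<Phi> t z) \<partial>lborel)}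
    \<le> 2 * (\<integral>\<^sup>+z. G z \<partial>M)"
proof -
  let ?A' = "\<lambda>h. {z \<in> space M. \<exists>R\<in>{R\<in>\<rat>. h \<le> R}. ennreal (c * R) < (\<integral>\<^sup>+t\<in>{0..R}. G (\<Phi> t z) \<partial>lborel)}"
  let ?h = "\<lambda>n. inverse (real (Suc n))"
  have A': "?A' h \<in> sets M" for h
  proof (rule sets.sets_Collect_countable_Ex')
    show "countable {R \<in> \<rat>. h \<le> R}" by (rule countable_subset[OF _ countable_rat]) auto
  qed measurable
  have "?A = (\<Union>n. ?A' (?h n))"
  proof safe
    fix z R assume R: "0 < R" "R \<in> \<rat>" and l: "ennreal (c * R) < (\<integral>\<^sup>+t\<in>{0..R}. G (\<Phi> t z) \<partial>lborel)" and z: "z \<in> space M"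
    from reals_Archimedean[OF R(1)] obtain n where "?h n < R" by blast
    then have "z \<in> ?A' (?h n)" using R z l by (intro CollectI conjI bexI[of _ R]) simp_all
    then show "z \<in> (\<Union>n. ?A' (?h n))" by (rule UN_I[OF UNIV_I])
  next
    fix z n R assume "R \<in> \<rat>" "?h n \<le> R" and l: "ennreal (c * R) < (\<integral>\<^sup>+t\<in>{0..R}. G (\<Phi> t z) \<partial>lborel)"
    moreover have "0 < ?h n" by simp
    ultimately show "\<exists>R\<in>{R\<in>\<rat>. 0 < R}. ennreal (c * R) < (\<integral>\<^sup>+t\<in>{0..R}. G (\<Phi> t z) \<partial>lborel)"
      by (intro bexI[of _ R] CollectI conjI) (assumption | rule order_less_le_trans)+
  qed
  note A_eq = this
  show "?A \<in> sets M" unfolding A_eq by (intro sets.countable_nat_UN image_subsetI A')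
  have "emeasure M (\<Union>n. ?A' (?h n)) = (SUP n. emeasure M (?A' (?h n)))"
  proof (rule SUP_emeasure_incseq[symmetric])
    show "range (\<lambda>n. ?A' (?h n)) \<subseteq> sets M" by (intro image_subsetI A')
    show "incseq (\<lambda>n. ?A' (?h n))"
    proof (rule incseq_SucI, safe)
      fix n z R assume "R \<in> \<rat>" "?h n \<le> R" and l: "ennreal (c * R) < (\<integral>\<^sup>+t\<in>{0..R}. G (\<Phi> t z) \<partial>lborel)"
      moreover have "?h (Suc n) \<le> R"
        using \<open>?h n \<le> R\<close> by (rule order_trans[rotated]) (simp add: field_simps)
      ultimately show "\<exists>R\<in>{R\<in>\<rat>. ?h (Suc n) \<le> R}. ennreal (c * R) < (\<integral>\<^sup>+t\<in>{0..R}. G (\<Phi> t z) \<partial>lborel)"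
        by (intro bexI[of _ R] CollectI conjI)
    qed
  qed
  then have "ennreal c * emeasure M ?A = ennreal c * (SUP n. emeasure M (?A' (?h n)))"
    by (simp only: A_eq)
  also have "\<dots> = (SUP n. ennreal c * emeasure M (?A' (?h n)))"
    by (rule SUP_mult_left_ennreal)
  also have "\<dots> \<le> 2 * (\<integral>\<^sup>+z. G z \<partial>M)"
    by (rule SUP_least) (rule one_sided_weak_type_large[OF G c], simp)
  finally show "ennreal c * emeasure M ?A \<le> 2 * (\<integral>\<^sup>+z. G z \<partial>M)" .
qed

text \<open>Rational radii make the supremum countable, hence measurable. They suffice because the
  radii that arise later are dyadic numbers divided by a rational \<open>x\<close>. The
  normalization is by half the length of the interval.\<close>

definition flow_max :: "('a \<Rightarrow> ennreal) \<Rightarrow> 'a \<Rightarrow> ennreal" where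
  "flow_max G z = (SUP R\<in>{R\<in>\<rat>. 0 < R}. ennreal (1 / R) * (\<integral>\<^sup>+t\<in>{-R..R}. G (\<Phi> t z) \<partial>lborel))"

text \<open>A two-sided integral above c R forces one of its halves above (c/2) R. Each half
  contributes 2 at level c/2, and returning to level c doubles the sum, whence 8.\<close>

lemma flow_max_weak_type:
  fixes c :: real
  assumes G[measurable]: "G \<in> borel_measurable M" and c: "c > 0"
  shows "{z \<in> space M. ennreal c < flow_max G z} \<in> sets M" (is "?S \<in> _")
    and "ennreal c * emeasure M {z \<in> space M. ennreal c < flow_max G z} \<le> 8 * (\<integral>\<^sup>+z. G z \<partial>M)"
proof -
  interpret R: measure_flow M "\<lambda>t. \<Phi> (- t)" by (rule reversed_flow)
  let ?A = "{z \<in> space M. \<exists>R\<in>{R\<in>\<rat>. 0 < R}. ennreal (c / 2 * R) < (\<integral>\<^sup>+t\<in>{0..R}. G (\<Phi> t z) \<partial>lborel)}"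
  let ?B = "{z \<in> space M. \<exists>R\<in>{R\<in>\<rat>. 0 < R}. ennreal (c / 2 * R) < (\<integral>\<^sup>+t\<in>{0..R}. G (\<Phi> (- t) z) \<partial>lborel)}"
  have [measurable]: "flow_max G \<in> borel_measurable M"
    unfolding flow_max_def[abs_def]
  proof (rule borel_measurable_SUP)
    show "countable {R::real. R \<in> \<rat> \<and> 0 < R}" by (rule countable_subset[OF _ countable_rat]) auto
  qed measurable
  show "?S \<in> sets M" by measurable
  have "c / 2 > 0" using c by simp
  note A = one_sided_weak_type[OF G this] and B = R.one_sided_weak_type[OF G this]
  have "?S \<subseteq> ?A \<union> ?B"
  proof safe
    fix z assume z: "z \<in> space M" and l: "ennreal c < flow_max G z"
      and nB: "\<not> (\<exists>R\<in>{R\<in>\<rat>. 0 < R}. ennreal (c / 2 * R) < (\<integral>\<^sup>+t\<in>{0..R}. G (\<Phi> (- t) z) \<partial>lborel))"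
    from l obtain R where R: "R \<in> \<rat>" "0 < R" and lR: "ennreal c < ennreal (1 / R) * (\<integral>\<^sup>+t\<in>{-R..R}. G (\<Phi> t z) \<partial>lborel)"
      unfolding flow_max_def less_SUP_iff by auto
    have [measurable]: "(\<lambda>t. G (\<Phi> t z)) \<in> borel_measurable borel" using z by measurable
    have "ennreal R * ennreal c < ennreal R * (ennreal (1 / R) * (\<integral>\<^sup>+t\<in>{-R..R}. G (\<Phi> t z) \<partial>lborel))"
      using R lR by (intro ennreal_mult_strict_left_mono) auto
    then have "ennreal (c * R) < (\<integral>\<^sup>+t\<in>{-R..R}. G (\<Phi> t z) \<partial>lborel)"
      using R c by (simp flip: mult.assoc ennreal_mult add: mult.commute)
    also have "\<dots> \<le> (\<integral>\<^sup>+t. G (\<Phi> t z) * indicator {0..R} t + G (\<Phi> t z) * indicator {0..R} (- t) \<partial>lborel)"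
      by (intro nn_integral_mono) (auto simp: indicator_def)
    also have "\<dots> = (\<integral>\<^sup>+t\<in>{0..R}. G (\<Phi> t z) \<partial>lborel) + (\<integral>\<^sup>+t. G (\<Phi> t z) * indicator {0..R} (- t) \<partial>lborel)"
      by (rule nn_integral_add) auto
    also have "(\<integral>\<^sup>+t. G (\<Phi> t z) * indicator {0..R} (- t) \<partial>lborel) = (\<integral>\<^sup>+t\<in>{0..R}. G (\<Phi> (- t) z) \<partial>lborel)"
      by (subst nn_integral_real_affine[of _ "-1" 0]) auto
    also have "\<dots> \<le> ennreal (c / 2 * R)" using nB R by (auto simp: not_less)
    finally have l2: "ennreal (c * R) < (\<integral>\<^sup>+t\<in>{0..R}. G (\<Phi> t z) \<partial>lborel) + ennreal (c / 2 * R)"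
      by (auto simp: add_left_mono)
    have "ennreal (c / 2 * R) < (\<integral>\<^sup>+t\<in>{0..R}. G (\<Phi> t z) \<partial>lborel)"
    proof (rule ccontr)
      assume "\<not> ?thesis"
      then have "(\<integral>\<^sup>+t\<in>{0..R}. G (\<Phi> t z) \<partial>lborel) + ennreal (c / 2 * R) \<le> ennreal (c / 2 * R) + ennreal (c / 2 * R)"
        by (intro add_mono) auto
      also have "\<dots> = ennreal (c * R)" using c R by (simp flip: ennreal_plus)
      finally show False using l2 by simp
    qed
    then show "\<exists>R\<in>{R\<in>\<rat>. 0 < R}. ennreal (c / 2 * R) < (\<integral>\<^sup>+t\<in>{0..R}. G (\<Phi> t z) \<partial>lborel)"
      using R by blast
  qed
  then have "emeasure M ?S \<le> emeasure M ?A + emeasure M ?B"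
    using A(1) B(1) by (intro order_trans[OF emeasure_mono emeasure_subadditive]) auto
  then have "ennreal (c / 2) * emeasure M ?S \<le> ennreal (c / 2) * emeasure M ?A + ennreal (c / 2) * emeasure M ?B"
    by (simp add: mult_left_mono flip: distrib_left)
  also have "\<dots> \<le> 2 * (\<integral>\<^sup>+z. G z \<partial>M) + 2 * (\<integral>\<^sup>+z. G z \<partial>M)"
    by (rule add_mono[OF A(2) B(2)])
  also have "\<dots> = (2 + 2) * (\<integral>\<^sup>+z. G z \<partial>M)" by (simp only: distrib_right)
  finally have "2 * (ennreal (c / 2) * emeasure M ?S) \<le> 2 * ((2 + 2) * (\<integral>\<^sup>+z. G z \<partial>M))"
    by (rule mult_left_mono) simp
  moreover have "2 * ennreal (c / 2) = ennreal c"
    using c by (simp add: ennreal_mult' flip: ennreal_numeral ennreal_mult)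
  ultimately show "ennreal c * emeasure M ?S \<le> 8 * (\<integral>\<^sup>+z. G z \<partial>M)"
    by (simp flip: mult.assoc)
qed

text \<open>Slowing the flow by \<open>x\<close> only changes the radius to R/x, which is again an
  admissible rational radius. A single maximal function thus controls all \<open>x\<close> at
  once.\<close>

lemma nn_integral_interval_le_flow_max:
  fixes x R :: real
  assumes G[measurable]: "G \<in> borel_measurable M" and z: "z \<in> space M"
    and x: "x \<in> \<rat>" "x > 0" and R: "R \<in> \<rat>" "R > 0"
  shows "(\<integral>\<^sup>+t\<in>{-R..R}. G (\<Phi> (t / x) z) \<partial>lborel) \<le> ennreal R * flow_max G z"
proof -
  have [measurable]: "(\<lambda>t. G (\<Phi> t z)) \<in> borel_measurable borel" using z by measurable
  have "(\<integral>\<^sup>+t\<in>{-R..R}. G (\<Phi> (t / x) z) \<partial>lborel) = ennreal x * (\<integral>\<^sup>+t\<in>{-(R / x)..R / x}. G (\<Phi> t z) \<partial>lborel)"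
    using x z by (subst nn_integral_real_affine[of _ x 0])
      (auto simp: indicator_def field_simps intro!: arg_cong[where f = "\<lambda>i. ennreal x * i"] nn_integral_cong)
  also have "\<dots> = ennreal R * (ennreal (1 / (R / x)) * (\<integral>\<^sup>+t\<in>{-(R / x)..R / x}. G (\<Phi> t z) \<partial>lborel))"
    using x R by (simp flip: mult.assoc ennreal_mult)
  also have "\<dots> \<le> ennreal R * flow_max G z"
    unfolding flow_max_def using x R by (intro mult_left_mono SUP_upper) auto
  finally show ?thesis .
qed

text \<open>The substitution \<open>s = x t\<close> turns this into the convolution with the dilated kernel \<open>x * K (x * t)\<close>.\<close>

definition flow_conv :: "(real \<Rightarrow> real) \<Rightarrow> real \<Rightarrow> ('a \<Rightarrow> complex) \<Rightarrow> 'a \<Rightarrow> complex" where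
  "flow_conv K x f z = (LINT s|lborel. complex_of_real (K s) * f (\<Phi> (s / x) z))"

lemma integral_flow:
  fixes f :: "'a \<Rightarrow> 'b::{banach, second_countable_topology}"
  assumes "integrable M f"
  shows "integrable M (\<lambda>z. f (\<Phi> t z))" "(LINT z|M. f (\<Phi> t z)) = (LINT z|M. f z)"
  using integrable_comp_distr[OF flow_time_measurable flow_invariant assms] by auto

text \<open>By Tonelli and invariance the joint integral of the modulus is the product of the L1
  norms of \<open>K\<close> and \<open>f\<close>. The null set in the third claim depends on
  \<open>x\<close>.\<close>

lemma flow_conv_integrable:
  assumes K: "integrable lborel K" and f: "integrable M f"
  shows "integrable (M \<Otimes>\<^sub>M lborel) (\<lambda>(z, s). complex_of_real (K s) * f (\<Phi> (s / x) z))"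
    and "integrable M (flow_conv K x f)"
    and "AE z in M. integrable lborel (\<lambda>s. complex_of_real (K s) * f (\<Phi> (s / x) z))"
proof -
  interpret pair_sigma_finite M lborel ..
  have [measurable]: "K \<in> borel_measurable borel" "f \<in> borel_measurable M" using K f by auto
  let ?F = "\<lambda>(z, s). complex_of_real (K s) * f (\<Phi> (s / x) z)"
  have "(\<integral>\<^sup>+p. norm (?F p) \<partial>(M \<Otimes>\<^sub>M lborel)) = (\<integral>\<^sup>+s. \<integral>\<^sup>+z. norm (?F (z, s)) \<partial>M \<partial>lborel)"
    by (rule nn_integral_snd[symmetric]) measurable
  also have "\<dots> = (\<integral>\<^sup>+s. ennreal \<bar>K s\<bar> * (\<integral>\<^sup>+z. norm (f z) \<partial>M) \<partial>lborel)"
  proof (rule nn_integral_cong)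
    fix s
    have "(\<integral>\<^sup>+z. norm (?F (z, s)) \<partial>M) = (\<integral>\<^sup>+z. ennreal \<bar>K s\<bar> * ennreal (norm (f (\<Phi> (s / x) z))) \<partial>M)"
      by (intro nn_integral_cong) (simp add: norm_mult ennreal_mult)
    also have "\<dots> = ennreal \<bar>K s\<bar> * (\<integral>\<^sup>+z. ennreal (norm (f (\<Phi> (s / x) z))) \<partial>M)"
      by (rule nn_integral_cmult) measurable
    also have "(\<integral>\<^sup>+z. ennreal (norm (f (\<Phi> (s / x) z))) \<partial>M) = (\<integral>\<^sup>+z. norm (f z) \<partial>M)"
      by (rule nn_integral_flow) measurable
    finally show "(\<integral>\<^sup>+z. norm (?F (z, s)) \<partial>M) = ennreal \<bar>K s\<bar> * (\<integral>\<^sup>+z. norm (f z) \<partial>M)" .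
  qed
  also have "\<dots> = (\<integral>\<^sup>+s. ennreal \<bar>K s\<bar> \<partial>lborel) * (\<integral>\<^sup>+z. norm (f z) \<partial>M)"
    by (rule nn_integral_multc) measurable
  also have "\<dots> < \<infinity>"
    using K f by (simp add: integrable_iff_bounded ennreal_mult_less_top)
  finally show int: "integrable (M \<Otimes>\<^sub>M lborel) ?F" by (intro integrableI_bounded) auto
  show "integrable M (flow_conv K x f)"
    using integrable_fst'[OF int] by (simp add: flow_conv_def[abs_def])
  show "AE z in M. integrable lborel (\<lambda>s. complex_of_real (K s) * f (\<Phi> (s / x) z))"
    using AE_integrable_fst'[OF int] by simp
qed

lemma flow_conv_diff:
  assumes "integrable lborel (\<lambda>s. complex_of_real (K s) * f (\<Phi> (s / x) z))"
    and "integrable lborel (\<lambda>s. complex_of_real (K s) * g (\<Phi> (s / x) z))"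
  shows "flow_conv K x (\<lambda>z. f z - g z) z = flow_conv K x f z - flow_conv K x g z"
  using assms by (simp add: flow_conv_def right_diff_distrib)

text \<open>Dyadic domination of the kernel turns the convolution into a geometric series of orbit
  averages, each bounded by the maximal function whatever \<open>x\<close> is.\<close>

lemma norm_flow_conv_le:
  fixes K :: "real \<Rightarrow> real" and C q c :: real
  assumes K: "\<And>t. \<exists>m::nat. \<bar>t\<bar> \<le> 2 ^ m \<and> \<bar>K t\<bar> \<le> C * q ^ m / 2 ^ m"
    and C: "0 < C" "0 < q" "q < 1"
    and f[measurable]: "f \<in> borel_measurable M" and z: "z \<in> space M" and x: "x \<in> \<rat>" "x > 0"
    and c: "flow_max (\<lambda>z. ennreal (norm (f z))) z \<le> ennreal c" "0 \<le> c"
  shows "norm (flow_conv K x f z) \<le> C / (1 - q) * c"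
proof (cases "integrable lborel (\<lambda>s. complex_of_real (K s) * f (\<Phi> (s / x) z))")
  case True
  let ?N = "flow_max (\<lambda>z. ennreal (norm (f z))) z"
  have [measurable]: "(\<lambda>s. f (\<Phi> (s / x) z)) \<in> borel_measurable borel" using z by measurable
  have "ennreal (norm (flow_conv K x f z)) \<le> (\<integral>\<^sup>+s. norm (complex_of_real (K s) * f (\<Phi> (s / x) z)) \<partial>lborel)"
    unfolding flow_conv_def by (rule integral_norm_bound_ennreal[OF True])
  also have "\<dots> = (\<integral>\<^sup>+s. ennreal \<bar>K s\<bar> * ennreal (norm (f (\<Phi> (s / x) z))) \<partial>lborel)"
    by (intro nn_integral_cong) (simp add: norm_mult ennreal_mult)
  also have "\<dots> \<le> ennreal (C / (1 - q)) * ?N"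
  proof (rule dyadic_kernel_nn_integral_le[OF K C])
    show "(\<integral>\<^sup>+s\<in>{- (2 ^ m)..2 ^ m}. ennreal (norm (f (\<Phi> (s / x) z))) \<partial>lborel) \<le> 2 ^ m * ?N" for m :: nat
      using nn_integral_interval_le_flow_max[of "\<lambda>z. ennreal (norm (f z))" z x "2 ^ m"] z x
      by (simp flip: ennreal_power)
  qed measurable
  also have "\<dots> \<le> ennreal (C / (1 - q)) * ennreal c" by (rule mult_left_mono[OF c(1)]) simp
  also have "\<dots> = ennreal (C / (1 - q) * c)" using C c by (intro ennreal_mult[symmetric]) auto
  finally show ?thesis using C c by (simp add: ennreal_le_iff)
next
  case False
  \<comment> \<open>A nonintegrable integrand has integral 0 by convention, so the bound
    persists.\<close>
  then have "flow_conv K x f z = 0" unfolding flow_conv_def by (rule not_integrable_integral_eq)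
  then show ?thesis using C c by simp
qed

text \<open>Chebyshev's inequality for \<open>norm \<circ> h n\<close> and the weak type bound for its maximal function
  together make the exceptional set of each fixed \<open>c\<close> null.\<close>

lemma AE_ex_small_flow_max:
  fixes h :: "nat \<Rightarrow> 'a \<Rightarrow> complex"
  assumes h: "\<And>n. integrable M (h n)" and lim: "(\<lambda>n. LINT z|M. norm (h n z)) \<longlonglongrightarrow> 0" and c: "c > 0"
  shows "AE z in M. \<exists>n. flow_max (\<lambda>z. ennreal (norm (h n z))) z \<le> ennreal c \<and> norm (h n z) \<le> c"
proof -
  have hm[measurable]: "h n \<in> borel_measurable M" for n using h by simp
  let ?G = "\<lambda>n z. ennreal (norm (h n z))"
  define A where "A n = {z \<in> space M. ennreal c < flow_max (?G n) z}" for n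
  define B where "B n = {z \<in> space M. c < norm (h n z)}" for n
  have Gm: "?G n \<in> borel_measurable M" for n by measurable
  have A: "A n \<in> sets M" for n unfolding A_def by (rule flow_max_weak_type(1)[OF Gm c])
  have B: "B n \<in> sets M" for n unfolding B_def by measurable
  have bound: "ennreal c * emeasure M (A n \<union> B n) \<le> ennreal (9 * (LINT z|M. norm (h n z)))" for n
  proof -
    have int: "(\<integral>\<^sup>+z. ?G n z \<partial>M) = ennreal (LINT z|M. norm (h n z))"
      using h by (intro nn_integral_eq_integral) auto
    have "ennreal c * emeasure M (B n) = (\<integral>\<^sup>+z. ennreal c * indicator (B n) z \<partial>M)"
      using B by (simp add: nn_integral_cmult_indicator)
    also have "\<dots> \<le> (\<integral>\<^sup>+z. ?G n z \<partial>M)"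
      by (intro nn_integral_mono) (auto simp: B_def indicator_def ennreal_leI)
    finally have 1: "ennreal c * emeasure M (B n) \<le> ennreal (LINT z|M. norm (h n z))"
      unfolding int .
    have 2: "ennreal c * emeasure M (A n) \<le> 8 * ennreal (LINT z|M. norm (h n z))"
      unfolding A_def int[symmetric] by (rule flow_max_weak_type(2)[OF Gm c])
    have "ennreal c * emeasure M (A n \<union> B n) \<le> ennreal c * (emeasure M (A n) + emeasure M (B n))"
      by (intro mult_left_mono emeasure_subadditive A B) simp
    also have "\<dots> \<le> 8 * ennreal (LINT z|M. norm (h n z)) + ennreal (LINT z|M. norm (h n z))"
      unfolding distrib_left by (rule add_mono[OF 2 1])
    also have "8 * ennreal (LINT z|M. norm (h n z)) = ennreal (8 * (LINT z|M. norm (h n z)))"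
      by (simp add: ennreal_mult')
    also have "\<dots> + ennreal (LINT z|M. norm (h n z)) = ennreal (9 * (LINT z|M. norm (h n z)))"
      by (simp flip: ennreal_plus)
    finally show ?thesis .
  qed
  define E where "E = (\<Inter>n. A n \<union> B n)"
  have E: "E \<in> sets M" unfolding E_def using A B by (intro sets.countable_INT) auto
  have "(\<lambda>n. ennreal (9 * (LINT z|M. norm (h n z)))) \<longlonglongrightarrow> ennreal (9 * 0)"
    by (intro tendsto_ennrealI tendsto_mult tendsto_const lim)
  moreover have "ennreal c * emeasure M E \<le> ennreal (9 * (LINT z|M. norm (h n z)))" for n
    using A B by (intro order_trans[OF mult_left_mono bound] emeasure_mono) (auto simp: E_def)
  ultimately have "ennreal c * emeasure M E \<le> ennreal (9 * 0)"
    by (intro LIMSEQ_le_const) auto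
  then have "emeasure M E = 0" using c by simp
  then show ?thesis
    by (intro AE_I[of _ _ E] E) (auto simp: E_def A_def B_def not_le)
qed

end

section \<open>Density of generating algebras\<close>

text \<open>The measure enters only through its sets, so the same \<open>P\<close> and
  \<open>G\<close> serve for other measures on the same sigma-algebra. Products are matched on the
  space only, since characters multiply only where the coordinates are nonzero.\<close>

locale generating_algebra =
  fixes M :: "'a measure" and P :: "('a \<Rightarrow> complex) set" and G :: "('a \<Rightarrow> real) set"
  assumes P_meas: "\<And>p. p \<in> P \<Longrightarrow> p \<in> borel_measurable M"
    and P_bdd: "\<And>p. p \<in> P \<Longrightarrow> \<exists>B. \<forall>z\<in>space M. norm (p z) \<le> B"
    and P_const: "\<And>c. (\<lambda>_. c) \<in> P"
    and P_add: "\<And>p q. p \<in> P \<Longrightarrow> q \<in> P \<Longrightarrow> (\<lambda>z. p z + q z) \<in> P"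
    and P_mult: "\<And>p q. p \<in> P \<Longrightarrow> q \<in> P \<Longrightarrow> \<exists>r\<in>P. \<forall>z\<in>space M. r z = p z * q z"
    and P_real: "\<And>g. g \<in> G \<Longrightarrow> \<exists>p\<in>P. \<forall>z\<in>space M. p z = complex_of_real (g z)"
    and G_generates: "\<And>N. space N = space M \<Longrightarrow> (\<And>g. g \<in> G \<Longrightarrow> g \<in> borel_measurable N) \<Longrightarrow> sets M \<subseteq> sets N"
begin

lemma generating_algebra_cong:
  assumes "sets N = sets M" shows "generating_algebra N P G"
proof -
  have [simp]: "space N = space M" by (rule sets_eq_imp_space_eq[OF assms])
  show ?thesis
    by unfold_locales
      (use P_meas P_bdd P_const P_add P_mult P_real G_generates assms in \<open>auto simp: measurable_cong_sets[OF assms refl]\<close>)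
qed

end

locale finite_generating_algebra = generating_algebra + finite_measure M
begin

lemma bounded_integrable:
  fixes f :: "'a \<Rightarrow> complex"
  assumes "f \<in> borel_measurable M" "\<And>z. z \<in> space M \<Longrightarrow> norm (f z) \<le> B"
  shows "integrable M f"
  using assms by (intro integrable_const_bound[of _ B]) auto

lemma P_integrable: "p \<in> P \<Longrightarrow> integrable M p"
  using P_bdd P_meas bounded_integrable by metis

definition L1_closure :: "('a \<Rightarrow> complex) set" where
  "L1_closure = {f. integrable M f \<and> (\<forall>e>0. \<exists>p\<in>P. (LINT z|M. norm (f z - p z)) < e)}"

lemma L1_closure_integrable: "f \<in> L1_closure \<Longrightarrow> integrable M f"
  by (simp add: L1_closure_def)

lemma L1_closureD: "f \<in> L1_closure \<Longrightarrow> e > 0 \<Longrightarrow> \<exists>p\<in>P. (LINT z|M. norm (f z - p z)) < e"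
  by (simp add: L1_closure_def)

lemma L1_triangle:
  fixes f g h :: "'a \<Rightarrow> complex"
  assumes [intro]: "integrable M f" "integrable M g" "integrable M h"
  shows "(LINT z|M. norm (f z - h z)) \<le> (LINT z|M. norm (f z - g z)) + (LINT z|M. norm (g z - h z))"
proof -
  have "(LINT z|M. norm (f z - h z)) \<le> (LINT z|M. norm (f z - g z) + norm (g z - h z))"
  proof (rule integral_mono)
    show "norm (f z - h z) \<le> norm (f z - g z) + norm (g z - h z)" for z
      using norm_triangle_ineq[of "f z - g z" "g z - h z"] by simp
  qed (intro Bochner_Integration.integrable_add Bochner_Integration.integrable_diff integrable_norm assms)+
  also have "\<dots> = (LINT z|M. norm (f z - g z)) + (LINT z|M. norm (g z - h z))"
    by (intro Bochner_Integration.integral_add integrable_norm Bochner_Integration.integrable_diff assms)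
  finally show ?thesis .
qed

lemma L1_closure_closed:
  assumes f: "integrable M f" and v: "\<And>e. e > 0 \<Longrightarrow> \<exists>v\<in>L1_closure. (LINT z|M. norm (f z - v z)) < e"
  shows "f \<in> L1_closure"
  unfolding L1_closure_def
proof (intro CollectI conjI f allI impI)
  fix e :: real assume "e > 0"
  then have e: "e / 2 > 0" by simp
  from v[OF e] obtain v where v: "v \<in> L1_closure" "(LINT z|M. norm (f z - v z)) < e / 2" by blast
  from L1_closureD[OF v(1) e] obtain p where p: "p \<in> P" "(LINT z|M. norm (v z - p z)) < e / 2" by blast
  have "(LINT z|M. norm (f z - p z)) < e"
    using L1_triangle[OF f L1_closure_integrable[OF v(1)] P_integrable[OF p(1)]] v(2) p(2) by simp
  then show "\<exists>p\<in>P. (LINT z|M. norm (f z - p z)) < e" using p(1) by blast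
qed

lemma L1_closure_superset: "p \<in> P \<Longrightarrow> p \<in> L1_closure"
  unfolding L1_closure_def using P_integrable by (auto intro!: bexI[of _ p])

lemma L1_closure_cong:
  assumes "f \<in> L1_closure" "g \<in> borel_measurable M" "\<And>z. z \<in> space M \<Longrightarrow> g z = f z"
  shows "g \<in> L1_closure"
proof (rule L1_closure_closed)
  show "integrable M g" using L1_closure_integrable[OF assms(1)] assms(3) by (simp cong: Bochner_Integration.integrable_cong)
  fix e :: real assume "e > 0"
  have "(LINT z|M. norm (g z - f z)) = (LINT z|M. 0)"
    using assms(3) by (intro Bochner_Integration.integral_cong) auto
  then show "\<exists>v\<in>L1_closure. (LINT z|M. norm (g z - v z)) < e"
    using assms(1) \<open>e > 0\<close> by (intro bexI[of _ f]) auto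
qed

lemma L1_closure_add:
  assumes f: "f \<in> L1_closure" and g: "g \<in> L1_closure" shows "(\<lambda>z. f z + g z) \<in> L1_closure"
  unfolding L1_closure_def
proof (intro CollectI conjI allI impI)
  note fi = L1_closure_integrable[OF f] and gi = L1_closure_integrable[OF g]
  show int: "integrable M (\<lambda>z. f z + g z)" using fi gi by simp
  fix e :: real assume "e > 0"
  then have e: "e / 2 > 0" by simp
  from L1_closureD[OF f e] obtain p where p: "p \<in> P" "(LINT z|M. norm (f z - p z)) < e / 2" by blast
  from L1_closureD[OF g e] obtain q where q: "q \<in> P" "(LINT z|M. norm (g z - q z)) < e / 2" by blast
  note pi' = P_integrable[OF p(1)] and qi = P_integrable[OF q(1)]
  have "(LINT z|M. norm (f z + g z - (p z + q z))) \<le> (LINT z|M. norm (f z - p z) + norm (g z - q z))"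
  proof (rule integral_mono)
    show "norm (f z + g z - (p z + q z)) \<le> norm (f z - p z) + norm (g z - q z)" for z
      using norm_triangle_ineq[of "f z - p z" "g z - q z"] by (simp add: algebra_simps)
  qed (use fi gi pi' qi in auto)
  also have "\<dots> = (LINT z|M. norm (f z - p z)) + (LINT z|M. norm (g z - q z))"
    using fi gi pi' qi by (intro Bochner_Integration.integral_add) auto
  also have "\<dots> < e" using p(2) q(2) by simp
  finally show "\<exists>p\<in>P. (LINT z|M. norm (f z + g z - p z)) < e"
    by (rule bexI[OF _ P_add[OF p(1) q(1)]])
qed

lemma L1_norm_mult_less:
  fixes f g v :: "'a \<Rightarrow> complex"
  assumes f: "integrable M f" and g: "integrable M g" and v[measurable]: "v \<in> borel_measurable M"
    and B: "\<And>z. z \<in> space M \<Longrightarrow> norm (v z) \<le> B" "B > 0" and e: "(LINT z|M. norm (f z - g z)) < e / B"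
  shows "(LINT z|M. norm (f z * v z - g z * v z)) < e"
proof -
  have [measurable]: "f \<in> borel_measurable M" "g \<in> borel_measurable M" using f g by auto
  have "(LINT z|M. norm (f z * v z - g z * v z)) \<le> (LINT z|M. norm (f z - g z) * B)"
  proof (rule integral_mono')
    show "integrable M (\<lambda>z. norm (f z - g z) * B)" using f g by simp
    show "norm (f z * v z - g z * v z) \<le> norm (f z - g z) * B" if "z \<in> space M" for z
      using B(1)[OF that] by (simp flip: left_diff_distrib add: norm_mult mult_left_mono)
  qed (use B in auto)
  also have "\<dots> = (LINT z|M. norm (f z - g z)) * B" by simp
  also have "\<dots> < e" using e B(2) by (simp add: field_simps)
  finally show ?thesis .
qed

lemma L1_closure_mult_P:
  assumes v: "v \<in> L1_closure" and p: "p \<in> P" shows "(\<lambda>z. v z * p z) \<in> L1_closure"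
proof -
  obtain B0 where "\<forall>z\<in>space M. norm (p z) \<le> B0" using P_bdd[OF p] by blast
  \<comment> \<open>The maximum with 1 makes the bound positive, so that e may be divided by
    it.\<close>
  then have B: "norm (p z) \<le> max 1 B0" if "z \<in> space M" for z using that by force
  note vi = L1_closure_integrable[OF v]
  have [measurable]: "p \<in> borel_measurable M" "v \<in> borel_measurable M" using P_meas[OF p] vi by auto
  show ?thesis unfolding L1_closure_def
  proof (intro CollectI conjI allI impI)
    have "integrable M (\<lambda>z. complex_of_real (max 1 B0) * v z)" using vi by simp
    then show "integrable M (\<lambda>z. v z * p z)"
    proof (rule Bochner_Integration.integrable_bound)
      show "AE z in M. norm (v z * p z) \<le> norm (complex_of_real (max 1 B0) * v z)"
      proof (rule AE_I2)
        fix z assume "z \<in> space M"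
        have "norm (v z * p z) \<le> norm (v z) * max 1 B0"
          unfolding norm_mult using B[OF \<open>z \<in> space M\<close>] by (rule mult_left_mono) simp
        then show "norm (v z * p z) \<le> norm (complex_of_real (max 1 B0) * v z)"
          by (simp add: norm_mult mult.commute)
      qed
    qed measurable
    fix e :: real assume "e > 0"
    then have "e / max 1 B0 > 0" by simp
    from L1_closureD[OF v this] obtain q where q: "q \<in> P" "(LINT z|M. norm (v z - q z)) < e / max 1 B0" by blast
    from P_mult[OF q(1) p] obtain r where r: "r \<in> P" "\<And>z. z \<in> space M \<Longrightarrow> r z = q z * p z" by blast
    have "(LINT z|M. norm (v z * p z - r z)) = (LINT z|M. norm (v z * p z - q z * p z))"
      using r(2) by (intro Bochner_Integration.integral_cong) auto
    also have "\<dots> < e"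
      by (rule L1_norm_mult_less[OF vi P_integrable[OF q(1)] _ B _ q(2)]) auto
    finally show "\<exists>r\<in>P. (LINT z|M. norm (v z * p z - r z)) < e" using r(1) by blast
  qed
qed

text \<open>Approximants of \<open>u\<close> carry no uniform bound, so the factors are treated one
  at a time: \<open>u\<close> is replaced by some \<open>q\<close> in \<open>P\<close> while the
  bounded \<open>v\<close> is kept, and \<open>q * v\<close> lies in the closure by
  \<open>L1_closure_mult_P\<close>.\<close>

lemma L1_closure_mult:
  assumes u: "u \<in> L1_closure" and v: "v \<in> L1_closure"
    and B: "\<And>z. z \<in> space M \<Longrightarrow> norm (v z) \<le> B" "B > 0" and int: "integrable M (\<lambda>z. u z * v z)"
  shows "(\<lambda>z. u z * v z) \<in> L1_closure"
proof (rule L1_closure_closed[OF int])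
  fix e :: real assume "e > 0"
  then have "e / B > 0" using B(2) by simp
  from L1_closureD[OF u this] obtain q where q: "q \<in> P" "(LINT z|M. norm (u z - q z)) < e / B" by blast
  have "(LINT z|M. norm (u z * v z - q z * v z)) < e"
    using L1_closure_integrable[OF u] P_integrable[OF q(1)] L1_closure_integrable[OF v]
    by (intro L1_norm_mult_less[OF _ _ _ B q(2)]) auto
  moreover have "(\<lambda>z. q z * v z) \<in> L1_closure"
    using L1_closure_mult_P[OF v q(1)] by (simp add: mult.commute)
  ultimately show "\<exists>w\<in>L1_closure. (LINT z|M. norm (u z * v z - w z)) < e"
    by (rule bexI)
qed

lemma L1_closure_limit:
  fixes s :: "nat \<Rightarrow> 'a \<Rightarrow> complex" and w :: "'a \<Rightarrow> real"
  assumes f: "integrable M f" and s: "\<And>i. s i \<in> L1_closure"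
    and lim: "\<And>z. z \<in> space M \<Longrightarrow> (\<lambda>i. s i z) \<longlonglongrightarrow> f z"
    and dom: "\<And>i z. z \<in> space M \<Longrightarrow> norm (s i z) \<le> w z" and w: "integrable M w"
  shows "f \<in> L1_closure"
proof (rule L1_closure_closed[OF f])
  fix e :: real assume e: "e > 0"
  have [measurable]: "f \<in> borel_measurable M" "s i \<in> borel_measurable M" for i
    using f L1_closure_integrable[OF s] by auto
  have "(\<lambda>i. LINT z|M. norm (f z - s i z)) \<longlonglongrightarrow> (LINT z|M. (0::real))"
  proof (rule integral_dominated_convergence[where w = "\<lambda>z. norm (f z) + w z"])
    show "AE z in M. (\<lambda>i. norm (f z - s i z)) \<longlonglongrightarrow> 0"
    proof (rule AE_I2)
      fix z assume "z \<in> space M"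
      from tendsto_norm[OF tendsto_diff[OF tendsto_const[of "f z"] lim[OF this]]]
      show "(\<lambda>i. norm (f z - s i z)) \<longlonglongrightarrow> 0" by simp
    qed
    show "AE z in M. norm (norm (f z - s i z)) \<le> norm (f z) + w z" for i
    proof (rule AE_I2)
      fix z assume "z \<in> space M"
      from dom[OF this, of i] show "norm (norm (f z - s i z)) \<le> norm (f z) + w z"
        using norm_triangle_ineq4[of "f z" "s i z"] by simp
    qed
  qed (use f w in auto)
  then have "\<forall>\<^sub>F i in sequentially. (LINT z|M. norm (f z - s i z)) < e"
    using e by (intro order_tendstoD(2)) auto
  then obtain i where "(LINT z|M. norm (f z - s i z)) < e" by (auto simp: eventually_sequentially)
  then show "\<exists>v\<in>L1_closure. (LINT z|M. norm (f z - v z)) < e" using s by blast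
qed

section \<open>The sigma-algebra of approximable sets\<close>

definition approx_sets :: "'a set set" where
  "approx_sets = {A \<in> sets M. (\<lambda>z. indicator A z) \<in> L1_closure}"

lemma approx_setsD: "A \<in> approx_sets \<Longrightarrow> A \<in> sets M" "A \<in> approx_sets \<Longrightarrow> (\<lambda>z. indicator A z) \<in> L1_closure"
  by (auto simp: approx_sets_def)

lemma approx_sets_compl:
  assumes A: "A \<in> approx_sets" shows "space M - A \<in> approx_sets"
proof -
  have m: "(\<lambda>z. 1 + indicator A z * (-1 :: complex)) \<in> L1_closure"
    by (intro L1_closure_add L1_closure_mult_P L1_closure_superset P_const approx_setsD(2) A)
  have "(\<lambda>z. indicator (space M - A) z) \<in> L1_closure"
    using approx_setsD(1)[OF A] by (intro L1_closure_cong[OF m]) (auto simp: indicator_def)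
  then show ?thesis using approx_setsD(1)[OF A] by (simp add: approx_sets_def)
qed

lemma approx_sets_Un:
  assumes A: "A \<in> approx_sets" and B: "B \<in> approx_sets" shows "A \<union> B \<in> approx_sets"
proof -
  note A' = approx_setsD[OF A] and B' = approx_setsD[OF B]
  have AB: "(\<lambda>z. indicator A z * indicator B z :: complex) \<in> L1_closure"
  proof (rule L1_closure_mult[OF A'(2) B'(2), of 1])
    show "integrable M (\<lambda>z. indicator A z * indicator B z :: complex)"
      using A'(1) B'(1) by (intro bounded_integrable[of _ 1]) (auto simp: indicator_def)
  qed (auto simp: indicator_def)
  have m: "(\<lambda>z. (indicator A z + indicator B z) + indicator A z * indicator B z * (-1 :: complex)) \<in> L1_closure"
    by (intro L1_closure_add L1_closure_mult_P AB P_const A' B')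
  have "(\<lambda>z. indicator (A \<union> B) z) \<in> L1_closure"
    using A' B' by (intro L1_closure_cong[OF m]) (auto simp: indicator_def)
  then show ?thesis using A'(1) B'(1) by (simp add: approx_sets_def)
qed

lemma approx_sets_empty: "{} \<in> approx_sets"
proof -
  have "indicator {} = (\<lambda>z::'a. 0::complex)" by (auto simp: fun_eq_iff)
  then show ?thesis by (simp add: approx_sets_def L1_closure_superset P_const)
qed

lemma approx_sets_finite_UN: "range A \<subseteq> approx_sets \<Longrightarrow> (\<Union>i<(n::nat). A i) \<in> approx_sets"
  by (induction n) (auto simp: lessThan_Suc approx_sets_empty intro: approx_sets_Un)

text \<open>Finite unions come from closure under products and sums, countable ones from dominated
  convergence of the indicators of the partial unions.\<close>

lemma sigma_algebra_approx_sets: "sigma_algebra (space M) approx_sets"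
  unfolding sigma_algebra_iff2
proof (intro conjI ballI allI impI)
  show "approx_sets \<subseteq> Pow (space M)" using approx_setsD(1) sets.sets_into_space by blast
  show "{} \<in> approx_sets" by (rule approx_sets_empty)
  show "space M - A \<in> approx_sets" if "A \<in> approx_sets" for A by (rule approx_sets_compl[OF that])
  fix A :: "nat \<Rightarrow> 'a set" assume A: "range A \<subseteq> approx_sets"
  have m: "(\<Union>i. A i) \<in> sets M" using A approx_setsD(1) by blast
  have "(\<lambda>z. indicator (\<Union>i. A i) z) \<in> L1_closure"
  proof (rule L1_closure_limit)
    show "integrable M (\<lambda>z. indicator (\<Union>i. A i) z :: complex)"
      by (intro bounded_integrable[of _ 1] borel_measurable_indicator m) (simp add: indicator_def)
    show "(\<lambda>z. indicator (\<Union>i<n. A i) z) \<in> L1_closure" for n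
      by (rule approx_setsD(2)[OF approx_sets_finite_UN[OF A]])
    show "(\<lambda>n. indicator (\<Union>i<n. A i) z) \<longlonglongrightarrow> (indicator (\<Union>i. A i) z :: complex)" for z
      by (rule LIMSEQ_indicator_UN)
    show "norm (indicator (\<Union>i<n. A i) z :: complex) \<le> 1" for n z by (simp add: indicator_def)
  qed simp
  then show "(\<Union>i. A i) \<in> approx_sets" using m by (simp add: approx_sets_def)
qed

lemma polynomial_in_P:
  assumes g: "g \<in> G" and \<pi>: "real_polynomial_function (\<pi> :: real \<Rightarrow> real)"
  shows "\<exists>p\<in>P. \<forall>z\<in>space M. p z = complex_of_real (\<pi> (g z))"
  using \<pi>
proof induction
  case (linear h)
  obtain p where p: "p \<in> P" "\<forall>z\<in>space M. p z = complex_of_real (g z)" using P_real[OF g] by blast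
  from P_mult[OF p(1) P_const[of "h 1"]] obtain r where r: "r \<in> P" "\<forall>z\<in>space M. r z = p z * complex_of_real (h 1)" by blast
  have "r z = complex_of_real (h (g z))" if "z \<in> space M" for z
    using linear_simps(5)[OF linear, of "g z" 1] r(2) p(2) that by simp
  with r(1) show ?case by blast
next
  case (const c)
  then show ?case by (intro bexI[OF _ P_const[of "complex_of_real c"]]) simp
next
  case (add f h)
  then obtain p q where pq: "p \<in> P" "\<forall>z\<in>space M. p z = complex_of_real (f (g z))"
    "q \<in> P" "\<forall>z\<in>space M. q z = complex_of_real (h (g z))" by blast
  then show ?case by (intro bexI[OF _ P_add[OF pq(1,3)]]) simp
next
  case (mult f h)
  then obtain p q where pq: "p \<in> P" "\<forall>z\<in>space M. p z = complex_of_real (f (g z))"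
    "q \<in> P" "\<forall>z\<in>space M. q z = complex_of_real (h (g z))" by blast
  from P_mult[OF pq(1,3)] obtain r where "r \<in> P" "\<forall>z\<in>space M. r z = p z * q z" by blast
  with pq(2,4) show ?case by (intro bexI[of _ r]) simp_all
qed

lemma G_bounded_measurable:
  assumes g: "g \<in> G"
  shows "g \<in> borel_measurable M" "\<exists>B>0. \<forall>z\<in>space M. \<bar>g z\<bar> \<le> B"
proof -
  obtain p where p: "p \<in> P" "\<forall>z\<in>space M. p z = complex_of_real (g z)" using P_real[OF g] by blast
  have [measurable]: "p \<in> borel_measurable M" by (rule P_meas[OF p(1)])
  have "(\<lambda>z. Re (p z)) \<in> borel_measurable M" by measurable
  then show "g \<in> borel_measurable M" using p(2) by (simp cong: measurable_cong)
  obtain B where "\<forall>z\<in>space M. norm (p z) \<le> B" using P_bdd[OF p(1)] by blast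
  then show "\<exists>B>0. \<forall>z\<in>space M. \<bar>g z\<bar> \<le> B"
    using p(2) by (intro exI[of _ "max 1 B"]) (auto simp: le_max_iff_disj)
qed

text \<open>Weierstrass approximation on a compact interval containing the range of
  \<open>g\<close>; uniform approximation is L1 approximation because the measure is finite.\<close>

lemma continuous_in_L1_closure:
  assumes g: "g \<in> G" and \<psi>: "continuous_on UNIV (\<psi> :: real \<Rightarrow> real)"
  shows "(\<lambda>z. complex_of_real (\<psi> (g z))) \<in> L1_closure"
proof -
  obtain B where B: "B > 0" "\<forall>z\<in>space M. \<bar>g z\<bar> \<le> B" using G_bounded_measurable[OF g] by blast
  have [measurable]: "g \<in> borel_measurable M" "\<psi> \<in> borel_measurable borel"
    using G_bounded_measurable[OF g] \<psi> by (auto intro: borel_measurable_continuous_onI)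
  have cont: "continuous_on {-B..B} \<psi>" using \<psi> by (rule continuous_on_subset) simp
  have "bounded (\<psi> ` {-B..B})" by (intro compact_imp_bounded compact_continuous_image cont) simp
  then obtain C where "\<forall>x\<in>{-B..B}. \<bar>\<psi> x\<bar> \<le> C" by (auto simp: bounded_iff)
  then have C: "\<bar>\<psi> x\<bar> \<le> C" if "x \<in> {-B..B}" for x using that by blast
  have gB: "g z \<in> {-B..B}" if "z \<in> space M" for z using B(2) that by (force simp: abs_le_iff)
  have int: "integrable M (\<lambda>z. complex_of_real (\<psi> (g z)))"
    using C[OF gB] by (intro bounded_integrable[of _ C]) simp_all
  show ?thesis
  proof (rule L1_closure_closed[OF int])
    fix e :: real assume e: "e > 0"
    \<comment> \<open>The added 1 keeps the divisor positive for the zero measure and makes the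
      final estimate strict.\<close>
    let ?m = "measure M (space M) + 1"
    have m: "?m > 0" by (simp add: add_nonneg_pos)
    have "e / ?m > 0" using e m by simp
    from Stone_Weierstrass_real_polynomial_function[OF compact_Icc cont this]
    obtain \<pi> where \<pi>: "real_polynomial_function \<pi>" "\<And>x. x \<in> {-B..B} \<Longrightarrow> \<bar>\<psi> x - \<pi> x\<bar> < e / ?m" by blast
    obtain p where p: "p \<in> P" "\<forall>z\<in>space M. p z = complex_of_real (\<pi> (g z))"
      using polynomial_in_P[OF g \<pi>(1)] by blast
    have "(LINT z|M. norm (complex_of_real (\<psi> (g z)) - p z)) \<le> (LINT z|M. e / ?m)"
    proof (rule integral_mono)
      show "norm (complex_of_real (\<psi> (g z)) - p z) \<le> e / ?m" if "z \<in> space M" for z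
        using \<pi>(2)[OF gB[OF that]] p(2) that by (simp flip: of_real_diff)
    qed (use int P_integrable[OF p(1)] in auto)
    also have "\<dots> = e * (measure M (space M) / ?m)" by simp
    also have "\<dots> < e * 1" using e m by (intro mult_strict_left_mono) auto
    finally show "\<exists>v\<in>L1_closure. (LINT z|M. norm (complex_of_real (\<psi> (g z)) - v z)) < e"
      using L1_closure_superset[OF p(1)] by (intro bexI[of _ p]) auto
  qed
qed

text \<open>Continuous ramps of slope n starting at \<open>c\<close> converge to the indicator of
  the open half-line; they vanish at \<open>c\<close> itself, in agreement with the strict
  inequality.\<close>

lemma G_measurable_approx_sets:
  assumes g: "g \<in> G" shows "{z \<in> space M. c < g z} \<in> approx_sets"
proof -
  have [measurable]: "g \<in> borel_measurable M" by (rule G_bounded_measurable[OF g])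
  define \<psi> where "\<psi> n x = min 1 (max 0 (real n * (x - c)))" for n :: nat and x :: real
  have "(\<lambda>z. indicator {z \<in> space M. c < g z} z) \<in> L1_closure"
  proof (rule L1_closure_limit)
    show "integrable M (\<lambda>z. indicator {z \<in> space M. c < g z} z :: complex)"
      by (intro bounded_integrable[of _ 1]) (auto simp: indicator_def)
    show "(\<lambda>z. complex_of_real (\<psi> n (g z))) \<in> L1_closure" for n
      unfolding \<psi>_def by (intro continuous_in_L1_closure[OF g] continuous_intros)
    show "norm (complex_of_real (\<psi> n (g z))) \<le> 1" for n z by (simp add: \<psi>_def)
    fix z assume z: "z \<in> space M"
    have lim: "(\<lambda>n. \<psi> n (g z)) \<longlonglongrightarrow> indicator {z \<in> space M. c < g z} z"
    proof (cases "c < g z")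
      case True
      obtain N :: nat where N: "1 / (g z - c) < real N" using reals_Archimedean2 by blast
      have "\<forall>\<^sub>F n in sequentially. \<psi> n (g z) = 1"
        using eventually_ge_at_top[of N]
      proof eventually_elim
        case (elim n)
        have "1 / (g z - c) \<le> real n" using N elim by linarith
        then have "1 \<le> real n * (g z - c)" using True by (simp add: divide_le_eq)
        then show ?case by (simp add: \<psi>_def)
      qed
      then show ?thesis using True z by (simp add: tendsto_eventually)
    next
      case False
      have "\<psi> n (g z) = 0" for n
      proof -
        have "real n * (g z - c) \<le> 0" using False by (intro mult_nonneg_nonpos) auto
        then show ?thesis by (simp add: \<psi>_def)
      qed
      then show ?thesis using False by simp
    qed
    have e: "complex_of_real (indicator {z \<in> space M. c < g z} z) = indicator {z \<in> space M. c < g z} z"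
      by (simp add: indicator_def)
    from tendsto_of_real[OF lim, where 'a = complex]
    show "(\<lambda>n. complex_of_real (\<psi> n (g z))) \<longlonglongrightarrow> indicator {z \<in> space M. c < g z} z"
      unfolding e .
  qed simp
  then show ?thesis by (simp add: approx_sets_def)
qed

text \<open>The approximable sets form a sigma-algebra for which every \<open>g\<close> in
  \<open>G\<close> is measurable, so they exhaust the measurable sets. Simple functions and
  dominated limits then follow by induction on integrability.\<close>

lemma L1_dense:
  assumes "integrable M f" shows "f \<in> L1_closure"
proof -
  interpret S: sigma_algebra "space M" approx_sets by (rule sigma_algebra_approx_sets)
  \<comment> \<open>The zero measure is a mere carrier of the sigma-algebra.\<close>
  define N where "N = measure_of (space M) approx_sets (\<lambda>_. 0)"
  have N: "space N = space M" "sets N = approx_sets"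
    unfolding N_def by (simp_all add: space_measure_of_conv S.sets_measure_of_eq)
  have "sets M \<subseteq> sets N"
  proof (rule G_generates[OF N(1)])
    show "g \<in> borel_measurable N" if "g \<in> G" for g
      unfolding borel_measurable_iff_greater N using G_measurable_approx_sets[OF that] by blast
  qed
  then have ind: "(\<lambda>z. indicator A z) \<in> L1_closure" if "A \<in> sets M" for A
    using that approx_setsD(2) N(2) by blast
  from assms show ?thesis
  proof induction
    case (base A c)
    have "(\<lambda>z. indicator A z * c) \<in> L1_closure" by (rule L1_closure_mult_P[OF ind[OF base(1)] P_const])
    moreover have "(\<lambda>z. indicator A z *\<^sub>R c) = (\<lambda>z. indicator A z * c)"
      by (auto simp: fun_eq_iff indicator_def)
    ultimately show ?case by (simp only:)
  next
    case (add f g)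
    then show ?case by (intro L1_closure_add)
  next
    case (lim f s)
    show ?case
      by (rule L1_closure_limit[OF lim(4) lim(5) lim(2) lim(3)]) (use lim(4) in auto)
  qed
qed

text \<open>The phase \<open>s\<close> with g s = |g| is approximated in L1 of the weighted measure
  |g| dM: then the integral of |g| equals that of g (s - p), which is at most the weighted distance
  from \<open>s\<close> to \<open>p\<close>. The weight is essential, since \<open>g\<close> may be
  unbounded and closeness in L1 of \<open>M\<close> would not control the product.\<close>

lemma L1_separating:
  fixes g :: "'a \<Rightarrow> complex"
  assumes g: "integrable M g" and 0: "\<And>p. p \<in> P \<Longrightarrow> (LINT z|M. g z * p z) = 0"
  shows "AE z in M. g z = 0"
proof -
  have [measurable]: "g \<in> borel_measurable M" using g by simp
  define \<nu> where "\<nu> = density M (\<lambda>z. ennreal (norm (g z)))"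
  have "finite_measure \<nu>"
  proof
    have "emeasure \<nu> (space \<nu>) = (\<integral>\<^sup>+z. ennreal (norm (g z)) \<partial>M)"
      unfolding \<nu>_def by (subst emeasure_density) (auto intro!: nn_integral_cong)
    then show "emeasure \<nu> (space \<nu>) \<noteq> \<infinity>" using g by (auto simp: integrable_iff_bounded)
  qed
  moreover have sets: "sets \<nu> = sets M" by (simp add: \<nu>_def)
  ultimately interpret D: finite_generating_algebra \<nu> P G
    by (intro finite_generating_algebra.intro generating_algebra_cong)
  \<comment> \<open>Where \<open>g\<close> vanishes the quotient is 0 by convention, and g s = |g|
    still holds.\<close>
  define s where "s z = cnj (g z) / complex_of_real (norm (g z))" for z
  have [measurable]: "cnj \<in> borel_measurable borel"
    by (intro borel_measurable_continuous_onI continuous_intros)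
  have [measurable]: "s \<in> borel_measurable M" unfolding s_def by measurable
  have "integrable \<nu> s"
    by (rule D.bounded_integrable[of _ 1]) (auto simp: \<nu>_def s_def norm_divide)
  then have s: "s \<in> D.L1_closure" by (rule D.L1_dense)
  have gs: "g z * s z = complex_of_real (norm (g z))" for z
  proof -
    have "g z * s z = complex_of_real ((norm (g z))\<^sup>2) / complex_of_real (norm (g z))"
      by (simp only: s_def complex_norm_square times_divide_eq_right)
    then show ?thesis by (simp add: power2_eq_square)
  qed
  have "(LINT z|M. norm (g z)) \<le> e" if "e > 0" for e
  proof -
    from D.L1_closureD[OF s that] obtain p where p: "p \<in> P" "(LINT z|\<nu>. norm (s z - p z)) < e" by blast
    have [measurable]: "p \<in> borel_measurable M" by (rule P_meas[OF p(1)])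
    have gp: "integrable M (\<lambda>z. g z * p z)"
      using L1_closure_integrable[OF L1_closure_mult_P[OF L1_dense[OF g] p(1)]] .
    have gsi: "integrable M (\<lambda>z. g z * s z)" unfolding gs using g by simp
    have "complex_of_real (LINT z|M. norm (g z)) = (LINT z|M. g z * s z) - (LINT z|M. g z * p z)"
      unfolding gs using 0[OF p(1)] by simp
    also have "\<dots> = (LINT z|M. g z * (s z - p z))"
      using gp gsi by (simp add: right_diff_distrib)
    finally have "\<bar>LINT z|M. norm (g z)\<bar> = norm (LINT z|M. g z * (s z - p z))"
      by (simp only: norm_of_real[symmetric, where 'a = complex])
    also have "\<dots> \<le> (LINT z|M. norm (g z * (s z - p z)))" by simp
    also have "\<dots> = (LINT z|\<nu>. norm (s z - p z))"
      unfolding \<nu>_def by (subst integral_density) (auto simp: norm_mult)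
    finally show ?thesis using p(2) by simp
  qed
  then have "(LINT z|M. norm (g z)) \<le> 0" by (rule field_le_epsilon) simp
  then have "(LINT z|M. norm (g z)) = 0" by (rule antisym) simp
  then show ?thesis using g by (subst (asm) integral_nonneg_eq_0_iff_AE) auto
qed

end

section \<open>Fourier analysis on the infinite torus\<close>

definition log_monomial :: "(nat \<Rightarrow>\<^sub>0 int) \<Rightarrow> real" where
  "log_monomial \<alpha> = (\<Sum>j\<in>Poly_Mapping.keys \<alpha>. of_int (Poly_Mapping.lookup \<alpha> j) * ln (real (nth_prime j)))"

lemma ln_prime_monomial: "ln (prime_monomial \<alpha>) = log_monomial \<alpha>"
proof -
  have pos: "real (nth_prime j) > 0" for j using nth_prime_ge_2[of j] by simp
  have "ln (prime_monomial \<alpha>) = (\<Sum>j\<in>Poly_Mapping.keys \<alpha>. ln (real (nth_prime j) powi Poly_Mapping.lookup \<alpha> j))"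
    unfolding prime_monomial_def using pos by (intro ln_prod) (auto intro: zero_less_power_int)
  also have "\<dots> = log_monomial \<alpha>"
    unfolding log_monomial_def using pos by (intro sum.cong refl) (simp add: powr_real_of_int' [symmetric] ln_powr)
  finally show ?thesis .
qed

section \<open>Characters of the torus\<close>

lemma character_superset:
  assumes "finite S" "Poly_Mapping.keys \<alpha> \<subseteq> S"
  shows "character \<alpha> z = (\<Prod>j\<in>S. z j powi Poly_Mapping.lookup \<alpha> j)"
  unfolding character_def using assms by (intro prod.mono_neutral_left) (auto simp: in_keys_iff)

lemma character_mult:
  assumes "z \<in> space torus"
  shows "character \<alpha> z * character \<beta> z = character (\<alpha> + \<beta>) z"
proof -
  let ?S = "Poly_Mapping.keys \<alpha> \<union> Poly_Mapping.keys \<beta>"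
  have nz: "z j \<noteq> 0" for j using assms by (auto simp: space_torus dest: spec[of _ j])
  have k: "Poly_Mapping.keys (\<alpha> + \<beta>) \<subseteq> ?S" by (rule Poly_Mapping.keys_add)
  show ?thesis
    unfolding character_superset[of ?S \<alpha>, simplified] character_superset[of ?S \<beta>, simplified]
      character_superset[OF _ k, simplified]
    using nz by (simp add: prod.distrib[symmetric] lookup_add power_int_add)
qed

lemma norm_character:
  assumes "z \<in> space torus" shows "norm (character \<alpha> z) = 1"
  using assms by (simp add: character_def space_torus prod_norm[symmetric] norm_power_int)

lemma cnj_character:
  assumes "z \<in> space torus" shows "cnj (character \<alpha> z) = character (- \<alpha>) z"
proof -
  have "character \<alpha> z * cnj (character \<alpha> z) = 1"
    using norm_character[OF assms, of \<alpha>] complex_norm_square[of "character \<alpha> z"] by simp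
  moreover have "character \<alpha> z * character (- \<alpha>) z = 1"
    unfolding character_mult[OF assms] by (simp add: character_def)
  moreover have "character \<alpha> z \<noteq> 0" using norm_character[OF assms, of \<alpha>] by auto
  ultimately show ?thesis by (metis mult_left_cancel)
qed

lemma torus_component_circle: "(\<lambda>z. z j) \<in> torus \<rightarrow>\<^sub>M circle"
  unfolding torus_def by (rule measurable_component_singleton) simp

lemma measurable_circle_iff:
  "f \<in> N \<rightarrow>\<^sub>M circle \<longleftrightarrow> f \<in> borel_measurable N \<and> (\<forall>x\<in>space N. norm (f x) = 1)"
  unfolding measurable_cong_sets[OF refl sets_circle]
  by (auto simp: measurable_restrict_space2_iff)

lemma torus_component_measurable [measurable]: "(\<lambda>z. z j) \<in> borel_measurable torus"
  using torus_component_circle by (simp add: measurable_circle_iff)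

lemma measurable_torusI:
  assumes "\<And>j. (\<lambda>x. f x j) \<in> borel_measurable N" "\<And>j x. x \<in> space N \<Longrightarrow> norm (f x j) = 1"
  shows "f \<in> N \<rightarrow>\<^sub>M torus"
  unfolding torus_def
proof (rule measurable_PiM_single')
  show "(\<lambda>x. f x j) \<in> N \<rightarrow>\<^sub>M circle" for j using assms by (simp add: measurable_circle_iff)
qed (use assms(2) in \<open>auto simp: space_circle\<close>)

lemma powi_measurable [measurable (raw)]:
  fixes f :: "'a \<Rightarrow> complex"
  assumes [measurable]: "f \<in> borel_measurable N" shows "(\<lambda>x. f x powi n) \<in> borel_measurable N"
  unfolding power_int_def by measurable

lemma character_measurable [measurable]: "character \<alpha> \<in> borel_measurable torus"
  unfolding character_def[abs_def] by measurable

section \<open>The Kronecker flow and its action on Fourier coefficients\<close>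

definition torus_flow :: "real \<Rightarrow> (nat \<Rightarrow> complex) \<Rightarrow> nat \<Rightarrow> complex" where
  "torus_flow t z = (\<lambda>j. cis (t * ln (real (nth_prime j))) * z j)"

interpretation torus: measure_flow torus torus_flow
proof (intro measure_flow.intro prob_space_torus measure_flow_axioms.intro)
  have [measurable]: "cis \<in> borel_measurable borel"
    by (intro borel_measurable_continuous_onI continuous_intros)
  show "(\<lambda>p. torus_flow (fst p) (snd p)) \<in> borel \<Otimes>\<^sub>M torus \<rightarrow>\<^sub>M torus"
    unfolding torus_flow_def
    by (rule measurable_torusI) (auto simp: norm_mult space_pair_measure space_torus)
  show "torus_flow (s + t) z = torus_flow s (torus_flow t z)" for s t z
    by (simp add: torus_flow_def fun_eq_iff distrib_right flip: cis_mult)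
  show "torus_flow 0 z = z" for z by (simp add: torus_flow_def)
  show "distr torus torus (torus_flow t) = torus" for t
    using torus_translation[of "\<lambda>j. cis (t * ln (real (nth_prime j)))"]
    by (simp add: torus_flow_def[abs_def] space_torus)
qed

lemma prod_cis: "(\<Prod>j\<in>S. cis (a j)) = cis (\<Sum>j\<in>S. a j)"
  by (induction S rule: infinite_finite_induct) (auto simp: cis_mult)

text \<open>Characters are eigenfunctions of the flow, and the logarithm that orders the sum is the
  eigenfrequency; the choice of the flow rests on this.\<close>

lemma character_torus_flow: "character \<alpha> (torus_flow t z) = cis (t * log_monomial \<alpha>) * character \<alpha> z"
proof -
  have "character \<alpha> (torus_flow t z)
      = (\<Prod>j\<in>Poly_Mapping.keys \<alpha>. cis (t * (of_int (Poly_Mapping.lookup \<alpha> j) * ln (real (nth_prime j)))) * z j powi Poly_Mapping.lookup \<alpha> j)"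
    unfolding character_def torus_flow_def
    by (intro prod.cong refl) (simp add: power_int_mult_distrib cis_power_int mult_ac)
  then show ?thesis
    by (simp add: prod.distrib prod_cis character_def log_monomial_def sum_distrib_left)
qed

lemma integrable_character_mult:
  assumes "integrable torus f" shows "integrable torus (\<lambda>z. f z * character \<alpha> z)"
  by (rule Bochner_Integration.integrable_bound[OF assms])
    (use assms in \<open>auto simp: norm_mult norm_character intro!: borel_measurable_times\<close>)

lemma integrable_character: "integrable torus (character \<alpha>)"
  using integrable_character_mult[of "\<lambda>_. 1"] by simp

lemma integrable_mult_cnj_character:
  assumes "integrable torus f" shows "integrable torus (\<lambda>z. f z * cnj (character \<alpha> z))"
  using integrable_character_mult[OF assms, of "- \<alpha>"]
  by (simp add: cnj_character cong: Bochner_Integration.integrable_cong)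

lemma integral_character:
  assumes "\<alpha> \<noteq> 0" shows "(LINT z|torus. character \<alpha> z) = 0"
proof -
  from assms obtain j where j: "Poly_Mapping.lookup \<alpha> j \<noteq> 0" by (metis poly_mapping_eqI lookup_zero)
  \<comment> \<open>A translation in coordinate \<open>j\<close> alone, by an angle chosen so that
    w_j^(\<alpha>_j) = cis pi = -1 for either sign of the exponent. The character changes sign while
    its integral is invariant.\<close>
  define w where "w i = (if i = j then cis (pi / of_int (Poly_Mapping.lookup \<alpha> j)) else 1)" for i
  have w: "w \<in> space torus" by (simp add: space_torus w_def)
  have jk: "j \<in> Poly_Mapping.keys \<alpha>" using j by (simp add: in_keys_iff)
  have "(\<Prod>i\<in>Poly_Mapping.keys \<alpha>. w i powi Poly_Mapping.lookup \<alpha> i)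
      = w j powi Poly_Mapping.lookup \<alpha> j * (\<Prod>i\<in>Poly_Mapping.keys \<alpha> - {j}. w i powi Poly_Mapping.lookup \<alpha> i)"
    using jk by (intro prod.remove) auto
  also have "(\<Prod>i\<in>Poly_Mapping.keys \<alpha> - {j}. w i powi Poly_Mapping.lookup \<alpha> i) = 1"
    by (intro prod.neutral) (auto simp: w_def)
  also have "w j powi Poly_Mapping.lookup \<alpha> j = -1"
    using j by (simp add: w_def cis_power_int)
  finally have "character \<alpha> (\<lambda>i. w i * z i) = - character \<alpha> z" for z
    by (simp add: character_def power_int_mult_distrib prod.distrib)
  moreover have "(LINT z|torus. character \<alpha> (\<lambda>i. w i * z i)) = (LINT z|torus. character \<alpha> z)"
  proof (rule integrable_comp_distr(2)[OF _ torus_translation[OF w] integrable_character])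
    show "(\<lambda>z i. w i * z i) \<in> torus \<rightarrow>\<^sub>M torus"
      using w by (intro measurable_torusI) (auto simp: norm_mult space_torus)
  qed
  ultimately show ?thesis by simp
qed

lemma fourier_coeff_character: "fourier_coeff (character \<alpha>) \<beta> = (if \<alpha> = \<beta> then 1 else 0)"
proof -
  have "fourier_coeff (character \<alpha>) \<beta> = (LINT z|torus. character (\<alpha> - \<beta>) z)"
    unfolding fourier_coeff_def
    by (intro Bochner_Integration.integral_cong) (auto simp: cnj_character character_mult)
  also have "\<dots> = (if \<alpha> = \<beta> then 1 else 0)"
    using integral_character[of "\<alpha> - \<beta>"] by (auto simp: character_def prob_space.prob_space[OF prob_space_torus])
  finally show ?thesis .
qed

lemma fourier_coeff_diff:
  assumes "integrable torus f" "integrable torus g"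
  shows "fourier_coeff (\<lambda>z. f z - g z) \<alpha> = fourier_coeff f \<alpha> - fourier_coeff g \<alpha>"
  using integrable_mult_cnj_character[OF assms(1), of \<alpha>] integrable_mult_cnj_character[OF assms(2), of \<alpha>]
  by (simp add: fourier_coeff_def left_diff_distrib)

lemma fourier_coeff_sum:
  assumes "finite S"
  shows "fourier_coeff (\<lambda>z. \<Sum>\<alpha>\<in>S. c \<alpha> * character \<alpha> z) \<beta> = (if \<beta> \<in> S then c \<beta> else 0)"
proof -
  have "fourier_coeff (\<lambda>z. \<Sum>\<alpha>\<in>S. c \<alpha> * character \<alpha> z) \<beta>
      = (LINT z|torus. (\<Sum>\<alpha>\<in>S. c \<alpha> * (character \<alpha> z * cnj (character \<beta> z))))"
    unfolding fourier_coeff_def by (simp add: sum_distrib_right mult.assoc)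
  also have "\<dots> = (\<Sum>\<alpha>\<in>S. c \<alpha> * fourier_coeff (character \<alpha>) \<beta>)"
    unfolding fourier_coeff_def
    using integrable_mult_cnj_character[OF integrable_character] by (subst Bochner_Integration.integral_sum) auto
  also have "\<dots> = (\<Sum>\<alpha>\<in>S. if \<alpha> = \<beta> then c \<alpha> else 0)"
    by (intro sum.cong) (auto simp: fourier_coeff_character)
  finally show ?thesis using assms by simp
qed

lemma fourier_coeff_torus_flow:
  assumes f: "integrable torus f"
  shows "(LINT z|torus. f (torus_flow t z) * cnj (character \<alpha> z)) = cis (t * log_monomial \<alpha>) * fourier_coeff f \<alpha>"
proof -
  have eq: "cnj (character \<alpha> z) = cis (t * log_monomial \<alpha>) * cnj (character \<alpha> (torus_flow t z))" for z
    by (simp add: character_torus_flow cis_cnj cis_mult flip: mult.assoc)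
  have "(LINT z|torus. f (torus_flow t z) * cnj (character \<alpha> z))
      = (LINT z|torus. cis (t * log_monomial \<alpha>) * (f (torus_flow t z) * cnj (character \<alpha> (torus_flow t z))))"
    by (subst eq) (simp add: mult_ac)
  also have "\<dots> = cis (t * log_monomial \<alpha>) * (LINT z|torus. f (torus_flow t z) * cnj (character \<alpha> (torus_flow t z)))"
    by simp
  also have "(LINT z|torus. f (torus_flow t z) * cnj (character \<alpha> (torus_flow t z))) = fourier_coeff f \<alpha>"
    unfolding fourier_coeff_def by (rule torus.integral_flow(2)[OF integrable_mult_cnj_character[OF f]])
  finally show ?thesis .
qed

text \<open>After Fubini the coefficient of each translate is a phase times that of
  \<open>f\<close>, and integrating the phase against the kernel returns the multiplier by
  \<open>fourier_riesz_kernel\<close>.\<close>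

lemma fourier_coeff_flow_conv:
  assumes k: "k > 0" and f: "integrable torus f"
  shows "fourier_coeff (torus.flow_conv (riesz_kernel k) x f) \<alpha> = riesz_mult k (log_monomial \<alpha> / x) * fourier_coeff f \<alpha>"
proof -
  interpret pair_sigma_finite torus lborel ..
  let ?K = "\<lambda>s. complex_of_real (riesz_kernel k s)"
  let ?F = "\<lambda>z s. ?K s * f (torus_flow (s / x) z)"
  note K = riesz_kernel_integrable[OF k]
  have I: "integrable (torus \<Otimes>\<^sub>M lborel) (\<lambda>(z, s). ?F z s * cnj (character \<alpha> z))"
  proof (rule Bochner_Integration.integrable_bound[OF torus.flow_conv_integrable(1)[OF K f, of x]])
    have [measurable]: "riesz_kernel k \<in> borel_measurable borel" "f \<in> borel_measurable torus"
      using f by (auto intro: riesz_kernel_measurable k)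
    have [measurable]: "cnj \<in> borel_measurable borel"
      by (intro borel_measurable_continuous_onI continuous_intros)
    show "(\<lambda>(z, s). ?F z s * cnj (character \<alpha> z)) \<in> borel_measurable (torus \<Otimes>\<^sub>M lborel)"
      by measurable
    show "AE p in torus \<Otimes>\<^sub>M lborel. norm (case p of (z, s) \<Rightarrow> ?F z s * cnj (character \<alpha> z)) \<le> norm (case p of (z, s) \<Rightarrow> ?F z s)"
      by (rule AE_I2) (auto simp: space_pair_measure norm_mult norm_character)
  qed
  have "fourier_coeff (torus.flow_conv (riesz_kernel k) x f) \<alpha> = (LINT z|torus. LINT s|lborel. ?F z s * cnj (character \<alpha> z))"
    unfolding fourier_coeff_def torus.flow_conv_def by simp
  also have "\<dots> = (LINT s|lborel. LINT z|torus. ?F z s * cnj (character \<alpha> z))"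
    by (rule Fubini_integral[OF I, symmetric])
  also have "\<dots> = (LINT s|lborel. ?K s * cis (log_monomial \<alpha> / x * s) * fourier_coeff f \<alpha>)"
  proof (rule Bochner_Integration.integral_cong[OF refl])
    fix s
    have "(LINT z|torus. ?F z s * cnj (character \<alpha> z)) = (LINT z|torus. ?K s * (f (torus_flow (s / x) z) * cnj (character \<alpha> z)))"
      by (simp add: mult.assoc)
    also have "\<dots> = ?K s * (LINT z|torus. f (torus_flow (s / x) z) * cnj (character \<alpha> z))"
      by simp
    also have "\<dots> = ?K s * cis (log_monomial \<alpha> / x * s) * fourier_coeff f \<alpha>"
      unfolding fourier_coeff_torus_flow[OF f] by (simp add: mult_ac)
    finally show "(LINT z|torus. ?F z s * cnj (character \<alpha> z)) = ?K s * cis (log_monomial \<alpha> / x * s) * fourier_coeff f \<alpha>" .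
  qed
  also have "\<dots> = (LINT s|lborel. ?K s * cis (log_monomial \<alpha> / x * s)) * fourier_coeff f \<alpha>"
    by simp
  finally show ?thesis unfolding fourier_riesz_kernel[OF k] .
qed

section \<open>Trigonometric polynomials, density and uniqueness\<close>

inductive_set trig_poly :: "((nat \<Rightarrow> complex) \<Rightarrow> complex) set" where
  trig_poly_character: "(\<lambda>z. c * character \<alpha> z) \<in> trig_poly"
| trig_poly_add: "p \<in> trig_poly \<Longrightarrow> q \<in> trig_poly \<Longrightarrow> (\<lambda>z. p z + q z) \<in> trig_poly"

lemma trig_poly_mult:
  assumes "p \<in> trig_poly" "q \<in> trig_poly"
  shows "\<exists>r\<in>trig_poly. \<forall>z\<in>space torus. r z = p z * q z"
  using assms(1)
proof induction
  case (trig_poly_character c \<alpha>)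
  show ?case using assms(2)
  proof induction
    case (trig_poly_character d \<beta>)
    show ?case
    proof (intro bexI ballI)
      show "(\<lambda>z. (c * d) * character (\<alpha> + \<beta>) z) \<in> trig_poly" by (rule trig_poly.trig_poly_character)
      show "(c * d) * character (\<alpha> + \<beta>) z = c * character \<alpha> z * (d * character \<beta> z)" if "z \<in> space torus" for z
        by (simp add: character_mult[OF that, symmetric] mult_ac)
    qed
  next
    case (trig_poly_add p q)
    then obtain r s where "r \<in> trig_poly" "\<forall>z\<in>space torus. r z = c * character \<alpha> z * p z"
      "s \<in> trig_poly" "\<forall>z\<in>space torus. s z = c * character \<alpha> z * q z" by blast
    then show ?case
      by (intro bexI[of _ "\<lambda>z. r z + s z"] trig_poly.trig_poly_add) (simp_all add: distrib_left)
  qed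
next
  case (trig_poly_add p p')
  then obtain r s where "r \<in> trig_poly" "\<forall>z\<in>space torus. r z = p z * q z"
    "s \<in> trig_poly" "\<forall>z\<in>space torus. s z = p' z * q z" by blast
  then show ?case
    by (intro bexI[of _ "\<lambda>z. r z + s z"] trig_poly.trig_poly_add) (simp_all add: distrib_right)
qed

lemma trig_poly_measurable: "p \<in> trig_poly \<Longrightarrow> p \<in> borel_measurable torus"
  by (induction rule: trig_poly.induct) auto

lemma trig_poly_bounded: "p \<in> trig_poly \<Longrightarrow> \<exists>B. \<forall>z\<in>space torus. norm (p z) \<le> B"
proof (induction rule: trig_poly.induct)
  case (trig_poly_character c \<alpha>)
  then show ?case by (intro exI[of _ "norm c"]) (simp add: norm_mult norm_character)
next
  case (trig_poly_add p q)
  then obtain B B' where "\<forall>z\<in>space torus. norm (p z) \<le> B" "\<forall>z\<in>space torus. norm (q z) \<le> B'" by blast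
  then show ?case by (intro exI[of _ "B + B'"]) (auto intro!: norm_triangle_mono)
qed

lemma character_single: "character (Poly_Mapping.single j n) z = z j powi n"
  by (cases "n = 0") (simp_all add: character_def)

interpretation torus_algebra: finite_generating_algebra torus trig_poly "range (\<lambda>j z. Re (z j)) \<union> range (\<lambda>j z. Im (z j))"
proof (intro finite_generating_algebra.intro generating_algebra.intro)
  show "finite_measure torus" using torus.finite_measure_axioms .
  show "p \<in> borel_measurable torus" if "p \<in> trig_poly" for p by (rule trig_poly_measurable[OF that])
  show "\<exists>B. \<forall>z\<in>space torus. norm (p z) \<le> B" if "p \<in> trig_poly" for p by (rule trig_poly_bounded[OF that])
  show "(\<lambda>_. c) \<in> trig_poly" for c using trig_poly_character[of c 0] by (simp add: character_def)
  show "(\<lambda>z. p z + q z) \<in> trig_poly" if "p \<in> trig_poly" "q \<in> trig_poly" for p q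
    by (rule trig_poly_add[OF that])
  show "\<exists>r\<in>trig_poly. \<forall>z\<in>space torus. r z = p z * q z" if "p \<in> trig_poly" "q \<in> trig_poly" for p q
    by (rule trig_poly_mult[OF that])
  show "\<exists>p\<in>trig_poly. \<forall>z\<in>space torus. p z = complex_of_real (g z)"
    if "g \<in> range (\<lambda>j z. Re (z j)) \<union> range (\<lambda>j z. Im (z j))" for g
  proof -
    \<comment> \<open>On the circle the inverse is the conjugate, so real and imaginary parts of a
      coordinate are combinations of its characters of degree 1 and -1.\<close>
    have inv: "inverse (z j) = cnj (z j)" if "z \<in> space torus" for z j
      using that divide_conv_cnj[of "z j" 1] by (simp add: space_torus field_simps)
    from that consider j where "g = (\<lambda>z. Re (z j))" | j where "g = (\<lambda>z. Im (z j))" by blast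
    then show ?thesis
    proof cases
      case 1
      show ?thesis
      proof (intro bexI ballI)
        show "(\<lambda>z. 1 / 2 * character (Poly_Mapping.single j 1) z + 1 / 2 * character (Poly_Mapping.single j (- 1)) z) \<in> trig_poly"
          by (intro trig_poly.intros)
        show "1 / 2 * character (Poly_Mapping.single j 1) z + 1 / 2 * character (Poly_Mapping.single j (- 1)) z = complex_of_real (g z)"
          if "z \<in> space torus" for z
          using inv[OF that, of j] by (simp add: 1 character_single power_int_minus complex_eq_iff)
      qed
    next
      case 2
      show ?thesis
      proof (intro bexI ballI)
        show "(\<lambda>z. - \<i> / 2 * character (Poly_Mapping.single j 1) z + \<i> / 2 * character (Poly_Mapping.single j (- 1)) z) \<in> trig_poly"
          by (intro trig_poly.intros)
        show "- \<i> / 2 * character (Poly_Mapping.single j 1) z + \<i> / 2 * character (Poly_Mapping.single j (- 1)) z = complex_of_real (g z)"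
          if "z \<in> space torus" for z
          using inv[OF that, of j] by (simp add: 2 character_single power_int_minus complex_eq_iff)
      qed
    qed
  qed
  show "sets torus \<subseteq> sets N" if N: "space N = space torus"
    and g: "\<And>g. g \<in> range (\<lambda>j z. Re (z j)) \<union> range (\<lambda>j z. Im (z j)) \<Longrightarrow> g \<in> borel_measurable N"
    for N :: "(nat \<Rightarrow> complex) measure"
  proof
    have "(\<lambda>z. z j) \<in> borel_measurable N" for j
      using g by (subst borel_measurable_complex_iff) auto
    \<comment> \<open>Measurability of the coordinates makes the identity measurable into the
      product space, which is the required inclusion of sigma-algebras.\<close>
    then have id: "(\<lambda>z. z) \<in> N \<rightarrow>\<^sub>M torus"
      by (rule measurable_torusI) (use N in \<open>auto simp: space_torus\<close>)
    fix A assume A: "A \<in> sets torus"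
    from measurable_sets[OF id A] sets.sets_into_space[OF A] show "A \<in> sets N"
      by (simp add: N Int_absorb2)
  qed
qed

lemma fourier_coeff_eq_0_imp_AE:
  assumes g: "integrable torus g" and 0: "\<And>\<alpha>. fourier_coeff g \<alpha> = 0"
  shows "AE z in torus. g z = 0"
proof (rule torus_algebra.L1_separating[OF g])
  have *: "(LINT z|torus. g z * p z) = 0 \<and> integrable torus (\<lambda>z. g z * p z)" if "p \<in> trig_poly" for p
    using that
  proof induction
    case (trig_poly_character c \<alpha>)
    have int: "integrable torus (\<lambda>z. g z * character \<alpha> z)" by (rule integrable_character_mult[OF g])
    have "(LINT z|torus. g z * character \<alpha> z) = fourier_coeff g (- \<alpha>)"
      unfolding fourier_coeff_def by (intro Bochner_Integration.integral_cong) (auto simp: cnj_character)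
    then have "(LINT z|torus. c * (g z * character \<alpha> z)) = 0" by (simp add: 0)
    moreover have "integrable torus (\<lambda>z. c * (g z * character \<alpha> z))" using int by simp
    moreover have "(\<lambda>z. c * (g z * character \<alpha> z)) = (\<lambda>z. g z * (c * character \<alpha> z))"
      by (simp add: fun_eq_iff mult_ac)
    ultimately show ?case by simp
  next
    case (trig_poly_add p q)
    then show ?case by (simp add: distrib_left)
  qed
  then show "(LINT z|torus. g z * p z) = 0" if "p \<in> trig_poly" for p using that by blast
qed

text \<open>On a character the convolution is multiplication by the multiplier at log p^\<alpha> /
  x, which tends to its value 1 at 0. The convergence holds at every \<open>z\<close>, with no
  exceptional set.\<close>

lemma trig_poly_flow_conv_tendsto:
  assumes k: "k > 0" and p: "p \<in> trig_poly"
  shows "((\<lambda>x. torus.flow_conv (riesz_kernel k) x p z) \<longlongrightarrow> p z) at_top"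
proof -
  let ?K = "\<lambda>s. complex_of_real (riesz_kernel k s)"
  \<comment> \<open>Integrability is carried through the induction, because additivity of the
    convolution depends on it.\<close>
  have "((\<lambda>x. torus.flow_conv (riesz_kernel k) x p z) \<longlongrightarrow> p z) at_top
      \<and> (\<forall>x. integrable lborel (\<lambda>s. ?K s * p (torus_flow (s / x) z)))"
    using p
  proof induction
    case (trig_poly_character c \<alpha>)
    let ?L = "log_monomial \<alpha>"
    have eq: "?K s * (c * character \<alpha> (torus_flow (s / x) z)) = (c * character \<alpha> z) * (?K s * cis (?L / x * s))" for s x
      by (simp add: character_torus_flow mult_ac)
    have [measurable]: "riesz_kernel k \<in> borel_measurable borel" by (rule riesz_kernel_measurable[OF k])
    have [measurable]: "cis \<in> borel_measurable borel"
      by (intro borel_measurable_continuous_onI continuous_intros)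
    have int: "integrable lborel (\<lambda>s. ?K s * cis (u * s))" for u
      by (rule Bochner_Integration.integrable_bound[OF riesz_kernel_integrable[OF k]]) (auto simp: norm_mult)
    have "integrable lborel (\<lambda>s. ?K s * (c * character \<alpha> (torus_flow (s / x) z)))" for x
      unfolding eq by (intro integrable_mult_right int)
    moreover have "torus.flow_conv (riesz_kernel k) x (\<lambda>z. c * character \<alpha> z) z = c * character \<alpha> z * riesz_mult k (?L / x)" for x
      unfolding torus.flow_conv_def eq integral_mult_right_zero fourier_riesz_kernel[OF k] ..
    moreover have "((\<lambda>x. c * character \<alpha> z * riesz_mult k (?L / x)) \<longlongrightarrow> c * character \<alpha> z * riesz_mult k 0) at_top"
    proof -
      have "((\<lambda>x. ?L / x) \<longlongrightarrow> 0) at_top"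
        by (intro real_tendsto_divide_at_top[OF tendsto_const] filterlim_ident)
      moreover have "isCont (riesz_mult k) 0"
        using riesz_mult_continuous[OF k, of UNIV] by (simp add: continuous_on_eq_continuous_at)
      ultimately have "((\<lambda>x. riesz_mult k (?L / x)) \<longlongrightarrow> riesz_mult k 0) at_top"
        using isCont_tendsto_compose by blast
      then show ?thesis by (intro tendsto_intros)
    qed
    ultimately show ?case by (simp add: riesz_mult_def)
  next
    case (trig_poly_add p q)
    then have "torus.flow_conv (riesz_kernel k) x (\<lambda>z. p z + q z) z
       = torus.flow_conv (riesz_kernel k) x p z + torus.flow_conv (riesz_kernel k) x q z" for x
      by (simp add: torus.flow_conv_def distrib_left)
    with trig_poly_add show ?case by (auto simp: distrib_left intro!: tendsto_add)
  qed
  then show ?thesis ..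
qed

section \<open>Riesz means as functions of their length and as convolutions\<close>

definition riesz_mean :: "real \<Rightarrow> ((nat \<Rightarrow> complex) \<Rightarrow> complex) \<Rightarrow> (nat \<Rightarrow> complex) \<Rightarrow> real \<Rightarrow> complex" where
  "riesz_mean k f z x = (\<Sum>\<alpha>\<in>multiindices_below x.
     fourier_coeff f \<alpha> * complex_of_real ((1 - ln (prime_monomial \<alpha>) / x) powr k) * character \<alpha> z)"

lemma log_monomial_nonneg:
  assumes "\<And>j. 0 \<le> Poly_Mapping.lookup \<alpha> j" shows "0 \<le> log_monomial \<alpha>"
  using powi_le_prime_monomial(1)[OF assms] by (simp flip: ln_prime_monomial)

lemma riesz_mult_below:
  assumes "\<alpha> \<in> multiindices_below x" "x > 0"
  shows "riesz_mult k (log_monomial \<alpha> / x) = (1 - ln (prime_monomial \<alpha>) / x) powr k"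
proof -
  have "0 \<le> log_monomial \<alpha>" "log_monomial \<alpha> < x"
    using assms(1) log_monomial_nonneg by (auto simp: multiindices_below_def ln_prime_monomial)
  then show ?thesis using assms(2) by (simp add: riesz_mult_def ln_prime_monomial)
qed

lemma riesz_mult_above:
  assumes "x > 0" "x \<le> log_monomial \<alpha>" shows "riesz_mult k (log_monomial \<alpha> / x) = 0"
  using assms by (simp add: riesz_mult_def)

text \<open>The multiplier vanishes on the added indices, so the index set can be frozen while
  \<open>x\<close> varies below \<open>X\<close>. This makes continuity in \<open>x\<close> visible
  although the original index set jumps.\<close>

lemma riesz_mean_eq:
  assumes "0 < x" "x \<le> X"
  shows "riesz_mean k f z x = (\<Sum>\<alpha>\<in>multiindices_below X. fourier_coeff f \<alpha> * complex_of_real (riesz_mult k (log_monomial \<alpha> / x)) * character \<alpha> z)"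
proof -
  have "riesz_mean k f z x = (\<Sum>\<alpha>\<in>multiindices_below x. fourier_coeff f \<alpha> * complex_of_real (riesz_mult k (log_monomial \<alpha> / x)) * character \<alpha> z)"
    unfolding riesz_mean_def using assms by (intro sum.cong refl) (simp add: riesz_mult_below)
  also have "\<dots> = (\<Sum>\<alpha>\<in>multiindices_below X. fourier_coeff f \<alpha> * complex_of_real (riesz_mult k (log_monomial \<alpha> / x)) * character \<alpha> z)"
  proof (rule sum.mono_neutral_left)
    show "multiindices_below x \<subseteq> multiindices_below X" using assms by (auto simp: multiindices_below_def)
    show "\<forall>\<alpha>\<in>multiindices_below X - multiindices_below x.
        fourier_coeff f \<alpha> * complex_of_real (riesz_mult k (log_monomial \<alpha> / x)) * character \<alpha> z = 0"
    proof
      fix \<alpha> assume "\<alpha> \<in> multiindices_below X - multiindices_below x"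
      then have "x \<le> log_monomial \<alpha>" by (auto simp: multiindices_below_def ln_prime_monomial)
      from riesz_mult_above[OF assms(1) this]
      show "fourier_coeff f \<alpha> * complex_of_real (riesz_mult k (log_monomial \<alpha> / x)) * character \<alpha> z = 0" by simp
    qed
  qed (rule finite_multiindices_below)
  finally show ?thesis .
qed

lemma isCont_riesz_mean:
  assumes k: "k > 0" and x: "x > 0"
  shows "isCont (riesz_mean k f z) x"
proof -
  have "continuous_on {0<..<x + 1} (\<lambda>y. \<Sum>\<alpha>\<in>multiindices_below (x + 1). fourier_coeff f \<alpha> * complex_of_real (riesz_mult k (log_monomial \<alpha> / y)) * character \<alpha> z)"
    by (intro continuous_intros continuous_on_compose2[OF riesz_mult_continuous[OF k, of UNIV]]) auto
  then have "continuous_on {0<..<x + 1} (riesz_mean k f z)"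
    by (rule continuous_on_eq[of _ "\<lambda>y. \<Sum>\<alpha>\<in>multiindices_below (x + 1). fourier_coeff f \<alpha> * complex_of_real (riesz_mult k (log_monomial \<alpha> / y)) * character \<alpha> z"])
       (simp add: riesz_mean_eq[of _ "x + 1"])
  then show ?thesis using x by (simp add: continuous_on_eq_continuous_at)
qed

text \<open>Both sides have the same coefficients: a negative exponent makes the coefficient of
  \<open>f\<close> vanish, and log p^\<alpha> \<ge> x makes the multiplier vanish. Membership in
  \<open>H1\<close> thus excludes the indices that the convolution would keep and the mean
  omits.\<close>

lemma riesz_mean_eq_flow_conv:
  assumes f: "f \<in> H1" and k: "k > 0" and x: "x > 0"
  shows "AE z in torus. riesz_mean k f z x = torus.flow_conv (riesz_kernel k) x f z"
proof -
  have fi: "integrable torus f" using f by (simp add: H1_def)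
  let ?T = "torus.flow_conv (riesz_kernel k) x f" and ?R = "\<lambda>z. riesz_mean k f z x"
  have Ti: "integrable torus ?T" by (rule torus.flow_conv_integrable(2)[OF riesz_kernel_integrable[OF k] fi])
  have Ri: "integrable torus ?R"
    unfolding riesz_mean_def by (intro Bochner_Integration.integrable_sum integrable_mult_right integrable_character)
  have "AE z in torus. ?R z - ?T z = 0"
  proof (rule fourier_coeff_eq_0_imp_AE)
    show "integrable torus (\<lambda>z. ?R z - ?T z)" using Ri Ti by simp
    fix \<alpha>
    have R: "fourier_coeff ?R \<alpha> = (if \<alpha> \<in> multiindices_below x then
        fourier_coeff f \<alpha> * complex_of_real ((1 - ln (prime_monomial \<alpha>) / x) powr k) else 0)"
      unfolding riesz_mean_def by (rule fourier_coeff_sum[OF finite_multiindices_below])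
    have "fourier_coeff ?R \<alpha> = riesz_mult k (log_monomial \<alpha> / x) * fourier_coeff f \<alpha>"
    proof (cases "\<exists>j. Poly_Mapping.lookup \<alpha> j < 0")
      case True
      then have "fourier_coeff f \<alpha> = 0" using f by (simp add: H1_def)
      then show ?thesis by (simp add: R)
    next
      case False
      then have nn: "0 \<le> Poly_Mapping.lookup \<alpha> j" for j by (simp add: not_less)
      show ?thesis
      proof (cases "log_monomial \<alpha> < x")
        case True
        then have "\<alpha> \<in> multiindices_below x" using nn by (simp add: multiindices_below_def ln_prime_monomial)
        then show ?thesis using riesz_mult_below[OF _ x, of \<alpha> k] by (simp add: R)
      next
        case False
        then have "\<alpha> \<notin> multiindices_below x" by (simp add: multiindices_below_def ln_prime_monomial)
        then show ?thesis using riesz_mult_above[OF x, of \<alpha> k] False by (simp add: R)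
      qed
    qed
    then show "fourier_coeff (\<lambda>z. ?R z - ?T z) \<alpha> = 0"
      by (simp add: fourier_coeff_diff[OF Ri Ti] fourier_coeff_flow_conv[OF k fi])
  qed
  then show ?thesis by eventually_elim simp
qed

section \<open>Almost everywhere convergence\<close>

text \<open>If the distance to the limit were at least e at some large \<open>x\<close>, continuity
  would keep it above e/2 near \<open>x\<close>, hence at a rational point where it is at most
  e/2.\<close>

lemma tendsto_at_top_if_rational:
  fixes g :: "real \<Rightarrow> 'a::metric_space"
  assumes cont: "\<And>x. x > 0 \<Longrightarrow> isCont g x"
    and rat: "\<And>e. e > 0 \<Longrightarrow> \<exists>X. \<forall>x\<in>\<rat>. X < x \<longrightarrow> dist (g x) l \<le> e"
  shows "(g \<longlongrightarrow> l) at_top"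
proof (rule tendstoI)
  fix e :: real assume "e > 0"
  then have "e / 2 > 0" by simp
  from rat[OF this] obtain X where X: "\<And>x. x \<in> \<rat> \<Longrightarrow> X < x \<Longrightarrow> dist (g x) l \<le> e / 2" by blast
  show "\<forall>\<^sub>F x in at_top. dist (g x) l < e"
    using eventually_gt_at_top[of "max X 0"]
  proof eventually_elim
    case (elim x)
    show ?case
    proof (rule ccontr)
      assume "\<not> dist (g x) l < e"
      then have "e / 2 < dist (g x) l" using \<open>e > 0\<close> by simp
      moreover have "isCont (\<lambda>y. dist (g y) l) x"
        using elim cont by (intro continuous_intros) auto
      ultimately have "\<forall>\<^sub>F y in at x. e / 2 < dist (g y) l"
        unfolding isCont_def by (intro order_tendstoD(1))
      then obtain d where d: "d > 0" "\<And>y. y \<noteq> x \<Longrightarrow> dist y x < d \<Longrightarrow> e / 2 < dist (g y) l"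
        by (auto simp: eventually_at)
      \<comment> \<open>The rational is taken strictly below \<open>x\<close>, because the
        neighbourhood provided by \<open>at x\<close> omits \<open>x\<close> itself.\<close>
      have "max X (x - d) < x" using elim d by auto
      from Rats_dense_in_real[OF this] obtain y where "y \<in> \<rat>" "max X (x - d) < y" "y < x" by blast
      then have "dist (g y) l \<le> e / 2" "y \<noteq> x" "dist y x < d"
        using X[of y] by (auto simp: dist_real_def)
      then show False using d(2)[of y] by simp
    qed
  qed
qed

text \<open>With T the convolution of length \<open>x\<close> and P an approximating polynomial, the
  error splits as T(f - P) + (TP - P) - (f - P): the maximal function bounds the first part for all
  rational \<open>x\<close> at once, the second tends to 0, and the third is small at the chosen
  point.\<close>

lemma riesz_mean_tendsto_AE:
  assumes f: "f \<in> H1" and k: "k > 0"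
  shows "AE z in torus. (riesz_mean k f z \<longlongrightarrow> f z) at_top"
proof -
  let ?K = "riesz_kernel k" and ?T = "torus.flow_conv (riesz_kernel k)"
  have fi: "integrable torus f" using f by (simp add: H1_def)
  note K = riesz_kernel_integrable[OF k]
  obtain C q where C: "0 < C" "0 < q" "q < 1"
    and dyadic: "\<And>t. \<exists>m::nat. \<bar>t\<bar> \<le> 2 ^ m \<and> \<bar>?K t\<bar> \<le> C * q ^ m / 2 ^ m"
    using riesz_kernel_dyadic_bound[OF k] by metis
  have "\<exists>p\<in>trig_poly. (LINT z|torus. norm (f z - p z)) < inverse (real (Suc n))" for n
    by (rule torus_algebra.L1_closureD[OF torus_algebra.L1_dense[OF fi]]) simp
  then obtain P where P: "\<And>n. P n \<in> trig_poly"
    "\<And>n. (LINT z|torus. norm (f z - P n z)) < inverse (real (Suc n))" by metis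
  have Pi: "integrable torus (P n)" for n by (rule torus_algebra.P_integrable[OF P(1)])
  define h where "h n z = f z - P n z" for n z
  have hi: "integrable torus (h n)" for n unfolding h_def using fi Pi by simp
  have h0: "(\<lambda>n. LINT z|torus. norm (h n z)) \<longlonglongrightarrow> 0"
  proof (rule tendsto_sandwich[OF _ _ tendsto_const LIMSEQ_inverse_real_of_nat])
    show "\<forall>\<^sub>F n in sequentially. 0 \<le> (LINT z|torus. norm (h n z))" by simp
    show "\<forall>\<^sub>F n in sequentially. (LINT z|torus. norm (h n z)) \<le> inverse (real (Suc n))"
      unfolding h_def using P(2) by (intro always_eventually allI less_imp_le)
  qed
  \<comment> \<open>All null sets, over the tolerances, the approximants and the rational
    \<open>x\<close>, are collected before \<open>z\<close> is fixed; only then may the approximant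
    depend on \<open>z\<close> and the tolerance.\<close>
  have small: "AE z in torus. \<forall>m. \<exists>n. torus.flow_max (\<lambda>z. ennreal (norm (h n z))) z \<le> ennreal (inverse (real (Suc m)))
      \<and> norm (h n z) \<le> inverse (real (Suc m))"
    unfolding AE_all_countable by (intro allI torus.AE_ex_small_flow_max[OF hi h0]) simp
  have count: "countable {x::real. x \<in> \<rat> \<and> 0 < x}"
    by (rule countable_subset[OF _ countable_rat]) auto
  have eq: "AE z in torus. \<forall>x\<in>{x. x \<in> \<rat> \<and> 0 < x}. riesz_mean k f z x = ?T x f z"
    unfolding AE_ball_countable[OF count] using riesz_mean_eq_flow_conv[OF f k] by blast
  have int: "AE z in torus. \<forall>x\<in>{x. x \<in> \<rat> \<and> 0 < x}. integrable lborel (\<lambda>s. complex_of_real (?K s) * f (torus_flow (s / x) z))"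
    unfolding AE_ball_countable[OF count] using torus.flow_conv_integrable(3)[OF K fi] by blast
  have int': "AE z in torus. \<forall>n. \<forall>x\<in>{x. x \<in> \<rat> \<and> 0 < x}. integrable lborel (\<lambda>s. complex_of_real (?K s) * P n (torus_flow (s / x) z))"
    unfolding AE_ball_countable[OF count] AE_all_countable using torus.flow_conv_integrable(3)[OF K Pi] by blast
  show ?thesis
    using small eq int int' AE_space
  proof eventually_elim
    case (elim z)
    show ?case
    proof (rule tendsto_at_top_if_rational)
      show "isCont (riesz_mean k f z) x" if "x > 0" for x by (rule isCont_riesz_mean[OF k that])
      fix e :: real assume e: "e > 0"
      define D where "D = C / (1 - q)"
      have D: "D \<ge> 0" using C by (simp add: D_def)
      have "e / (2 * (D + 1)) > 0" using e D by simp
      from reals_Archimedean[OF this] obtain m where m: "inverse (real (Suc m)) < e / (2 * (D + 1))" by blast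
      define c where "c = inverse (real (Suc m))"
      \<comment> \<open>The share D c pays for the convolution of the error, the extra c for the
        error at \<open>z\<close> itself; the remaining e/2 is left to the polynomial.\<close>
      have c: "c > 0" "(D + 1) * c \<le> e / 2"
        using m D by (auto simp: c_def field_simps)
      obtain n where n: "torus.flow_max (\<lambda>z. ennreal (norm (h n z))) z \<le> ennreal c" "norm (h n z) \<le> c"
        using elim(1) unfolding c_def by blast
      have "\<forall>\<^sub>F x in at_top. dist (?T x (P n) z) (P n z) < e / 2"
        using e by (intro tendstoD[OF trig_poly_flow_conv_tendsto[OF k P(1)]]) simp
      then obtain X where X: "\<And>x. X \<le> x \<Longrightarrow> dist (?T x (P n) z) (P n z) < e / 2"
        by (auto simp: eventually_at_top_linorder)
      show "\<exists>X. \<forall>x\<in>\<rat>. X < x \<longrightarrow> dist (riesz_mean k f z x) (f z) \<le> e"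
      proof (intro exI[of _ "max X 0"] ballI impI)
        fix x :: real assume x: "x \<in> \<rat>" "max X 0 < x"
        have "norm (?T x (h n) z) \<le> D * c"
          unfolding D_def using n(1) c(1) x hi elim(5)
          by (intro torus.norm_flow_conv_le[OF dyadic C]) auto
        moreover have "?T x (h n) z = ?T x f z - ?T x (P n) z"
          unfolding h_def using elim(3,4) x by (intro torus.flow_conv_diff) auto
        moreover have "riesz_mean k f z x = ?T x f z" using elim(2) x by simp
        moreover have "norm (?T x (P n) z - P n z) < e / 2" using X[of x] x by (simp add: dist_norm)
        moreover have "riesz_mean k f z x - f z = (riesz_mean k f z x - ?T x (P n) z) + ((?T x (P n) z - P n z) - h n z)"
          by (simp add: h_def)
        ultimately have "norm (riesz_mean k f z x - f z) \<le> D * c + (e / 2 + c)"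
          using n(2) by (smt (verit) norm_triangle_ineq norm_triangle_ineq4)
        also have "\<dots> \<le> e" using c(2) by (simp add: distrib_right)
        finally show "dist (riesz_mean k f z x) (f z) \<le> e" by (simp add: dist_norm)
      qed
    qed
  qed
qed

theorem corollary2p3:
  fixes f :: "(nat \<Rightarrow> complex) \<Rightarrow> complex" and k :: real
  assumes "f \<in> H1" and "k > 0"
  shows "AE z in torus.
    ((\<lambda>x::real. \<Sum>\<alpha>\<in>multiindices_below x.
        fourier_coeff f \<alpha> * complex_of_real ((1 - ln (prime_monomial \<alpha>) / x) powr k) * character \<alpha> z)
      \<longlongrightarrow> f z) at_top"
  using riesz_mean_tendsto_AE[OF assms] by (simp add: riesz_mean_def[abs_def])

end
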